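(* Let $\mathbf{k}$ be a field, let $G$ be a group and let $\mathfrak{A}:G\to G$ be a map. Let $$A:\mathbf{k}[G]\to\mathbf{k}[G],\qquad \sum_i\alpha_i g_i\mapsto\sum_i\alpha_i\,\mathfrak{A}(g_i)$$ be the linear extension of $\mathfrak{A}$ to the group algebra. Then $(G,\mathfrak{A})$ is an averaging group if and only if $(\mathbf{k}[G],A)$ is an averaging Hopf algebra.
   Context: An averaging group is a pair $(G,\mathfrak{A})$ where $G$ is a group and $\mathfrak{A}:G\to G$ is a map (not necessarily a homomorphism), called an averaging operator, such that $\mathfrak{A}(g)\mathfrak{A}(h)=\mathfrak{A}(\mathfrak{A}(g)h)=\mathfrak{A}(g\mathfrak{A}(h))$ for all $g,h\in G$. An averaging Hopf algebra is a pair $(H,A)$ where $H$ is a Hopf algebra and $A:H\to H$ is a coalgebra map such that $A(a)A(b)=A(A(a)b)=A(aA(b))$ for all $a,b\in H$. The group algebra $\mathbf{k}[G]$ is regarded as a cocommutative Hopf algebra with coproduct $\Delta(g)=g\otimes g$ and antipode $S(g)=g^{-1}$ for $g\in G$ (and counit $g\mapsto 1$), extended linearly. *)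

theory Defs
  imports "HOL-Algebra.Module" "HOL-Algebra.Free_Abelian_Groups"
begin

section \<open>Averaging groups\<close>

locale averaging_group = group G for G (structure) and \<AA> +
  assumes averaging_closed: "\<AA> \<in> carrier G \<rightarrow> carrier G"
    and averaging_left:
      "\<lbrakk>g \<in> carrier G; h \<in> carrier G\<rbrakk> \<Longrightarrow> \<AA> g \<otimes> \<AA> h = \<AA> (\<AA> g \<otimes> h)"
    and averaging_right:
      "\<lbrakk>g \<in> carrier G; h \<in> carrier G\<rbrakk> \<Longrightarrow> \<AA> g \<otimes> \<AA> h = \<AA> (g \<otimes> \<AA> h)"


section \<open>Linear maps and associative algebras\<close>

definition lin_hom ::
  "('k, 'r) ring_scheme \<Rightarrow> ('k, 'm, 'x) module_scheme \<Rightarrow> ('k, 'n, 'y) module_scheme \<Rightarrow> ('m \<Rightarrow> 'n) set"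
  where "lin_hom K M N = {f \<in> carrier M \<rightarrow> carrier N.
    (\<forall>x \<in> carrier M. \<forall>y \<in> carrier M. f (x \<oplus>\<^bsub>M\<^esub> y) = f x \<oplus>\<^bsub>N\<^esub> f y) \<and>
    (\<forall>a \<in> carrier K. \<forall>x \<in> carrier M. f (a \<odot>\<^bsub>M\<^esub> x) = a \<odot>\<^bsub>N\<^esub> f x)}"

definition scalars :: "('k, 'r) ring_scheme \<Rightarrow> ('k, 'k) module"
  where "scalars K = \<lparr>carrier = carrier K, monoid.mult = (\<otimes>\<^bsub>K\<^esub>), one = \<one>\<^bsub>K\<^esub>,
    ring.zero = \<zero>\<^bsub>K\<^esub>, add = (\<oplus>\<^bsub>K\<^esub>), smult = (\<otimes>\<^bsub>K\<^esub>)\<rparr>"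

text \<open>The locale \<open>algebra\<close> of HOL-Algebra is about commutative algebras only.\<close>

locale assoc_algebra = module K H + ring H for K and H (structure) +
  assumes smult_mult_left:
      "\<lbrakk>a \<in> carrier K; x \<in> carrier H; y \<in> carrier H\<rbrakk> \<Longrightarrow> (a \<odot> x) \<otimes> y = a \<odot> (x \<otimes> y)"
    and smult_mult_right:
      "\<lbrakk>a \<in> carrier K; x \<in> carrier H; y \<in> carrier H\<rbrakk> \<Longrightarrow> x \<otimes> (a \<odot> y) = a \<odot> (x \<otimes> y)"


section \<open>Tensor products\<close>

text \<open>
  The tensor product of two modules is the free abelian group on pairs modulo the subgroup
  generated by the relations of biadditivity and balancedness. Its elements are cosets of formal
  integer combinations of pairs.
\<close>

definition tensor_rels ::
  "('k, 'r) ring_scheme \<Rightarrow> ('k, 'm, 'x) module_scheme \<Rightarrow> ('k, 'n, 'y) module_scheme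
    \<Rightarrow> ('m \<times> 'n \<Rightarrow>\<^sub>0 int) set"
  where "tensor_rels K M N =
    {frag_of (x \<oplus>\<^bsub>M\<^esub> x', y) - frag_of (x, y) - frag_of (x', y) | x x' y.
       x \<in> carrier M \<and> x' \<in> carrier M \<and> y \<in> carrier N} \<union>
    {frag_of (x, y \<oplus>\<^bsub>N\<^esub> y') - frag_of (x, y) - frag_of (x, y') | x y y'.
       x \<in> carrier M \<and> y \<in> carrier N \<and> y' \<in> carrier N} \<union>
    {frag_of (a \<odot>\<^bsub>M\<^esub> x, y) - frag_of (x, a \<odot>\<^bsub>N\<^esub> y) | a x y.
       a \<in> carrier K \<and> x \<in> carrier M \<and> y \<in> carrier N}"

definition tensor_null ::
  "('k, 'r) ring_scheme \<Rightarrow> ('k, 'm, 'x) module_scheme \<Rightarrow> ('k, 'n, 'y) module_scheme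
    \<Rightarrow> ('m \<times> 'n \<Rightarrow>\<^sub>0 int) set"
  where "tensor_null K M N =
    generate (free_Abelian_group (carrier M \<times> carrier N)) (tensor_rels K M N)"

definition tensor_class ::
  "('k, 'r) ring_scheme \<Rightarrow> ('k, 'm, 'x) module_scheme \<Rightarrow> ('k, 'n, 'y) module_scheme
    \<Rightarrow> ('m \<times> 'n \<Rightarrow>\<^sub>0 int) \<Rightarrow> ('m \<times> 'n \<Rightarrow>\<^sub>0 int) set"
  where "tensor_class K M N p =
    tensor_null K M N #>\<^bsub>free_Abelian_group (carrier M \<times> carrier N)\<^esub> p"

definition pure_tensor ::
  "('k, 'r) ring_scheme \<Rightarrow> ('k, 'm, 'x) module_scheme \<Rightarrow> ('k, 'n, 'y) module_scheme
    \<Rightarrow> 'm \<Rightarrow> 'n \<Rightarrow> ('m \<times> 'n \<Rightarrow>\<^sub>0 int) set"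
  where "pure_tensor K M N x y = tensor_class K M N (frag_of (x, y))"

text \<open>
  Scalars act by \<open>a (x \<otimes> y) = (a x) \<otimes> y\<close>. The fields \<open>mult\<close> and \<open>one\<close> are those of the tensor
  product of algebras, \<open>(x \<otimes> y) (x' \<otimes> y') = (x x') \<otimes> (y y')\<close>; they are meaningful only if
  \<open>M\<close> and \<open>N\<close> are algebras. Both operations are defined on representatives and do not depend on
  the choice of these, so that \<open>the_elem\<close> is applied to singletons.
\<close>

definition tensor ::
  "('k, 'r) ring_scheme \<Rightarrow> ('k, 'm, 'x) module_scheme \<Rightarrow> ('k, 'n, 'y) module_scheme
    \<Rightarrow> ('k, ('m \<times> 'n \<Rightarrow>\<^sub>0 int) set) module"
  where "tensor K M N =
    (let Q = free_Abelian_group (carrier M \<times> carrier N) Mod tensor_null K M N in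
     \<lparr>carrier = carrier Q,
      monoid.mult = (\<lambda>T U. the_elem {tensor_class K M N
          (frag_extend (\<lambda>(x, y). frag_extend (\<lambda>(x', y'). frag_of (x \<otimes>\<^bsub>M\<^esub> x', y \<otimes>\<^bsub>N\<^esub> y')) q) p)
          | p q. p \<in> T \<and> q \<in> U}),
      one = pure_tensor K M N \<one>\<^bsub>M\<^esub> \<one>\<^bsub>N\<^esub>,
      ring.zero = \<one>\<^bsub>Q\<^esub>,
      add = (\<otimes>\<^bsub>Q\<^esub>),
      smult = (\<lambda>a T. the_elem
          ((\<lambda>p. tensor_class K M N (frag_extend (\<lambda>(x, y). frag_of (a \<odot>\<^bsub>M\<^esub> x, y)) p)) ` T))\<rparr>)"

text \<open>
  The map out of a tensor product into \<open>P\<close> induced by a bilinear map \<open>\<beta>\<close>, that is, the linear map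
  with \<open>x \<otimes> y \<mapsto> \<beta> x y\<close>. For bilinear \<open>\<beta>\<close> the sum does not depend on the representative \<open>p\<close>.
\<close>

definition tensor_lift ::
  "('p, 'z) ring_scheme \<Rightarrow> ('m \<Rightarrow> 'n \<Rightarrow> 'p) \<Rightarrow> ('m \<times> 'n \<Rightarrow>\<^sub>0 int) set \<Rightarrow> 'p"
  where "tensor_lift P \<beta> T = the_elem
    ((\<lambda>p. \<Oplus>\<^bsub>P\<^esub>z \<in> Poly_Mapping.keys p. [Poly_Mapping.lookup p z] \<cdot>\<^bsub>P\<^esub> case_prod \<beta> z) ` T)"

text \<open>The map \<open>f \<otimes> g\<close> into the tensor product of \<open>M\<close> and \<open>N\<close>.\<close>

definition tensor_map ::
  "('k, 'r) ring_scheme \<Rightarrow> ('k, 'm, 'x) module_scheme \<Rightarrow> ('k, 'n, 'y) module_scheme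
    \<Rightarrow> ('a \<Rightarrow> 'm) \<Rightarrow> ('b \<Rightarrow> 'n) \<Rightarrow> ('a \<times> 'b \<Rightarrow>\<^sub>0 int) set \<Rightarrow> ('m \<times> 'n \<Rightarrow>\<^sub>0 int) set"
  where "tensor_map K M N f g =
    tensor_lift (tensor K M N) (\<lambda>x y. pure_tensor K M N (f x) (g y))"

text \<open>The canonical isomorphism \<open>(x \<otimes> y) \<otimes> z \<mapsto> x \<otimes> (y \<otimes> z)\<close>.\<close>

definition tensor_assoc ::
  "('k, 'r) ring_scheme \<Rightarrow> ('k, 'm, 'x) module_scheme \<Rightarrow> ('k, 'n, 'y) module_scheme
    \<Rightarrow> ('k, 'p, 'z) module_scheme
    \<Rightarrow> (('m \<times> 'n \<Rightarrow>\<^sub>0 int) set \<times> 'p \<Rightarrow>\<^sub>0 int) set \<Rightarrow> ('m \<times> ('n \<times> 'p \<Rightarrow>\<^sub>0 int) set \<Rightarrow>\<^sub>0 int) set"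
  where "tensor_assoc K M N P =
    (let MNP = tensor K M (tensor K N P) in
     tensor_lift MNP (\<lambda>t z. tensor_lift MNP
       (\<lambda>x y. pure_tensor K M (tensor K N P) x (pure_tensor K N P y z)) t))"


section \<open>Coalgebras and Hopf algebras\<close>

record ('k, 'h) coalgebra = "('k, 'h) module" +
  comult :: "'h \<Rightarrow> ('h \<times> 'h \<Rightarrow>\<^sub>0 int) set"
  counit :: "'h \<Rightarrow> 'k"

record ('k, 'h) hopf_algebra = "('k, 'h) coalgebra" +
  antipode :: "'h \<Rightarrow> 'h"

text \<open>
  In \<open>counit_left\<close> and \<open>counit_right\<close> the tensor product of \<open>K\<close> and \<open>C\<close> is identified with \<open>C\<close>
  by the scalar action.
\<close>

locale coalgebra = field K + module K C for K and C (structure) +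
  assumes comult_linear: "comult C \<in> lin_hom K C (tensor K C C)"
    and counit_linear: "counit C \<in> lin_hom K C (scalars K)"
    and coassoc: "x \<in> carrier C \<Longrightarrow>
      tensor_assoc K C C C (tensor_map K (tensor K C C) C (comult C) id (comult C x)) =
      tensor_map K C (tensor K C C) id (comult C) (comult C x)"
    and counit_left: "x \<in> carrier C \<Longrightarrow>
      tensor_lift C (\<lambda>a y. a \<odot> y) (tensor_map K (scalars K) C (counit C) id (comult C x)) = x"
    and counit_right: "x \<in> carrier C \<Longrightarrow>
      tensor_lift C (\<lambda>y a. a \<odot> y) (tensor_map K C (scalars K) id (counit C) (comult C x)) = x"

locale bialgebra = coalgebra K H + assoc_algebra K H for K and H (structure) +
  assumes comult_ring_hom: "comult H \<in> ring_hom H (tensor K H H)"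
    and counit_ring_hom: "counit H \<in> ring_hom H K"

locale hopf_algebra = bialgebra K H for K and H (structure) +
  assumes antipode_linear: "antipode H \<in> lin_hom K H H"
    and antipode_left: "x \<in> carrier H \<Longrightarrow>
      tensor_lift H (\<lambda>y z. y \<otimes> z) (tensor_map K H H (antipode H) id (comult H x)) =
      counit H x \<odot> \<one>"
    and antipode_right: "x \<in> carrier H \<Longrightarrow>
      tensor_lift H (\<lambda>y z. y \<otimes> z) (tensor_map K H H id (antipode H) (comult H x)) =
      counit H x \<odot> \<one>"

definition coalgebra_hom ::
  "('k, 'r) ring_scheme \<Rightarrow> ('k, 'c, 'x) coalgebra_scheme \<Rightarrow> ('k, 'd, 'y) coalgebra_scheme
    \<Rightarrow> ('c \<Rightarrow> 'd) set"
  where "coalgebra_hom K C D = {f \<in> lin_hom K C D. \<forall>x \<in> carrier C.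
    comult D (f x) = tensor_map K D D f f (comult C x) \<and> counit D (f x) = counit C x}"

locale averaging_hopf_algebra = hopf_algebra K H for K and H (structure) and A +
  assumes averaging_coalgebra_hom: "A \<in> coalgebra_hom K H H"
    and averaging_left:
      "\<lbrakk>a \<in> carrier H; b \<in> carrier H\<rbrakk> \<Longrightarrow> A a \<otimes> A b = A (A a \<otimes> b)"
    and averaging_right:
      "\<lbrakk>a \<in> carrier H; b \<in> carrier H\<rbrakk> \<Longrightarrow> A a \<otimes> A b = A (a \<otimes> A b)"


section \<open>Group algebras\<close>

text \<open>
  Elements of the group algebra are the finitely supported functions from the group to the field,
  extended by zero outside of the carrier of the group.
\<close>

definition supp :: "('k, 'r) ring_scheme \<Rightarrow> ('g \<Rightarrow> 'k) \<Rightarrow> 'g set"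
  where "supp K f = {g. f g \<noteq> \<zero>\<^bsub>K\<^esub>}"

definition group_algebra ::
  "('k, 'r) ring_scheme \<Rightarrow> ('g, 's) monoid_scheme \<Rightarrow> ('k, 'g \<Rightarrow> 'k) module"
  where "group_algebra K G =
    \<lparr>carrier = {f \<in> UNIV \<rightarrow> carrier K. finite (supp K f) \<and> supp K f \<subseteq> carrier G},
     monoid.mult = (\<lambda>f f' x.
       \<Oplus>\<^bsub>K\<^esub>g \<in> supp K f. \<Oplus>\<^bsub>K\<^esub>h \<in> {h \<in> supp K f'. g \<otimes>\<^bsub>G\<^esub> h = x}. f g \<otimes>\<^bsub>K\<^esub> f' h),
     one = (\<lambda>x. if x = \<one>\<^bsub>G\<^esub> then \<one>\<^bsub>K\<^esub> else \<zero>\<^bsub>K\<^esub>),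
     ring.zero = (\<lambda>x. \<zero>\<^bsub>K\<^esub>),
     add = (\<lambda>f f' x. f x \<oplus>\<^bsub>K\<^esub> f' x),
     smult = (\<lambda>a f x. a \<otimes>\<^bsub>K\<^esub> f x)\<rparr>"

definition group_elem :: "('k, 'r) ring_scheme \<Rightarrow> 'g \<Rightarrow> 'g \<Rightarrow> 'k"
  where "group_elem K g = (\<lambda>x. if x = g then \<one>\<^bsub>K\<^esub> else \<zero>\<^bsub>K\<^esub>)"

text \<open>The linear extension of a map \<open>\<phi>\<close> from the group to a module \<open>M\<close>.\<close>

definition linear_extension ::
  "('k, 'r) ring_scheme \<Rightarrow> ('k, 'm, 'x) module_scheme \<Rightarrow> ('g \<Rightarrow> 'm) \<Rightarrow> ('g \<Rightarrow> 'k) \<Rightarrow> 'm"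
  where "linear_extension K M \<phi> f = (\<Oplus>\<^bsub>M\<^esub>g \<in> supp K f. f g \<odot>\<^bsub>M\<^esub> \<phi> g)"

definition group_hopf_algebra ::
  "('k, 'r) ring_scheme \<Rightarrow> ('g, 's) monoid_scheme \<Rightarrow> ('k, 'g \<Rightarrow> 'k) hopf_algebra"
  where "group_hopf_algebra K G =
    (let H = group_algebra K G in
     \<lparr>carrier = carrier H, monoid.mult = (\<otimes>\<^bsub>H\<^esub>), one = \<one>\<^bsub>H\<^esub>,
      ring.zero = \<zero>\<^bsub>H\<^esub>, add = (\<oplus>\<^bsub>H\<^esub>), smult = (\<odot>\<^bsub>H\<^esub>),
      comult = linear_extension K (tensor K H H)
        (\<lambda>g. pure_tensor K H H (group_elem K g) (group_elem K g)),
      counit = linear_extension K (scalars K) (\<lambda>g. \<one>\<^bsub>K\<^esub>),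
      antipode = linear_extension K H (\<lambda>g. group_elem K (inv\<^bsub>G\<^esub> g))\<rparr>)"

definition group_algebra_map ::
  "('k, 'r) ring_scheme \<Rightarrow> ('g, 's) monoid_scheme \<Rightarrow> ('g \<Rightarrow> 'g) \<Rightarrow> ('g \<Rightarrow> 'k) \<Rightarrow> ('g \<Rightarrow> 'k)"
  where "group_algebra_map K G \<AA> =
    linear_extension K (group_algebra K G) (\<lambda>g. group_elem K (\<AA> g))"

end

theory Submission
  imports Defs
begin

text \<open>
  Group elements form a basis of the group algebra, linear and bilinear maps are determined by their
  values on a basis, and \<open>A\<close> acts on basis vectors by \<open>\<AA>\<close>. The averaging identities for
  \<open>A\<close> compare bilinear maps, so they hold if and only if they hold on pairs of group elements,
  where they are the averaging identities for \<open>\<AA>\<close> (\<open>averaging_left_iff\<close>,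
  \<open>averaging_right_iff\<close>). Since \<open>A\<close> maps group elements to group elements, it is always a
  coalgebra map (\<open>group_algebra_map_coalgebra_hom\<close>).

  What remains is that the group algebra is a Hopf algebra at all (\<open>hopf_algebra_H\<close>). The same
  principle applies: each axiom compares composites of linear maps, and on a group element it reduces
  to an identity in the group (\<open>lin_hom_basis_ext\<close>). For this the constructions on tensor
  products, which are given by cosets of formal sums, must be known to be linear and to have the
  expected values on pure tensors. This is the purpose of the universal property
  (\<open>tensor_lift_linear\<close>, \<open>tensor_lift_pure\<close>), of its consequences for maps between tensor
  products and for the associator, and of the bilinearity of the product of a tensor product of
  algebras (\<open>mult_bilin\<close>).
\<close>


section \<open>Linear and bilinear maps\<close>

lemma lin_homI:
  assumes "\<And>x. x \<in> carrier M \<Longrightarrow> f x \<in> carrier N"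
    and "\<And>x y. \<lbrakk>x \<in> carrier M; y \<in> carrier M\<rbrakk> \<Longrightarrow> f (x \<oplus>\<^bsub>M\<^esub> y) = f x \<oplus>\<^bsub>N\<^esub> f y"
    and "\<And>a x. \<lbrakk>a \<in> carrier K; x \<in> carrier M\<rbrakk> \<Longrightarrow> f (a \<odot>\<^bsub>M\<^esub> x) = a \<odot>\<^bsub>N\<^esub> f x"
  shows "f \<in> lin_hom K M N"
  using assms by (auto simp: lin_hom_def)

lemma
  assumes "f \<in> lin_hom K M N"
  shows lin_hom_closed: "x \<in> carrier M \<Longrightarrow> f x \<in> carrier N"
    and lin_hom_add: "\<lbrakk>x \<in> carrier M; y \<in> carrier M\<rbrakk> \<Longrightarrow> f (x \<oplus>\<^bsub>M\<^esub> y) = f x \<oplus>\<^bsub>N\<^esub> f y"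
    and lin_hom_smult: "\<lbrakk>a \<in> carrier K; x \<in> carrier M\<rbrakk> \<Longrightarrow> f (a \<odot>\<^bsub>M\<^esub> x) = a \<odot>\<^bsub>N\<^esub> f x"
  using assms by (auto simp: lin_hom_def)

lemma lin_hom_id: "id \<in> lin_hom K M M"
  by (simp add: lin_hom_def)

lemma lin_hom_compose:
  assumes "f \<in> lin_hom K M N" "g \<in> lin_hom K N P"
  shows "(\<lambda>x. g (f x)) \<in> lin_hom K M P"
  using assms by (auto simp: lin_hom_def Pi_iff)

definition bilin_hom ::
  "('k, 'r) ring_scheme \<Rightarrow> ('k, 'm, 'x) module_scheme \<Rightarrow> ('k, 'n, 'y) module_scheme
    \<Rightarrow> ('k, 'p, 'z) module_scheme \<Rightarrow> ('m \<Rightarrow> 'n \<Rightarrow> 'p) set"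
  where "bilin_hom K M N P = {\<beta>.
    (\<forall>x \<in> carrier M. \<beta> x \<in> lin_hom K N P) \<and> (\<forall>y \<in> carrier N. (\<lambda>x. \<beta> x y) \<in> lin_hom K M P)}"

lemma bilin_homI:
  assumes "\<And>x. x \<in> carrier M \<Longrightarrow> \<beta> x \<in> lin_hom K N P"
    and "\<And>y. y \<in> carrier N \<Longrightarrow> (\<lambda>x. \<beta> x y) \<in> lin_hom K M P"
  shows "\<beta> \<in> bilin_hom K M N P"
  using assms by (simp add: bilin_hom_def)

lemma
  assumes "\<beta> \<in> bilin_hom K M N P"
  shows bilin_hom_left: "y \<in> carrier N \<Longrightarrow> (\<lambda>x. \<beta> x y) \<in> lin_hom K M P"
    and bilin_hom_right: "x \<in> carrier M \<Longrightarrow> \<beta> x \<in> lin_hom K N P"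
  using assms by (simp_all add: bilin_hom_def)

lemma bilin_hom_closed:
  assumes "\<beta> \<in> bilin_hom K M N P" "x \<in> carrier M" "y \<in> carrier N"
  shows "\<beta> x y \<in> carrier P"
  using assms by (meson bilin_hom_right lin_hom_closed)

lemma bilin_hom_compose:
  assumes "f \<in> lin_hom K A M" "g \<in> lin_hom K B N" "\<beta> \<in> bilin_hom K M N P"
  shows "(\<lambda>x y. \<beta> (f x) (g y)) \<in> bilin_hom K A B P"
proof (rule bilin_homI)
  fix x assume "x \<in> carrier A"
  then show "(\<lambda>y. \<beta> (f x) (g y)) \<in> lin_hom K B P"
    using assms by (intro lin_hom_compose[OF assms(2)] bilin_hom_right) (auto intro: lin_hom_closed)
next
  fix y assume "y \<in> carrier B"
  then show "(\<lambda>x. \<beta> (f x) (g y)) \<in> lin_hom K A P"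
    using assms by (intro lin_hom_compose[OF assms(1)] bilin_hom_left) (auto intro: lin_hom_closed)
qed

lemma lin_hom_bilin_hom_compose:
  assumes "\<beta> \<in> bilin_hom K M N P" "f \<in> lin_hom K P Q"
  shows "(\<lambda>x y. f (\<beta> x y)) \<in> bilin_hom K M N Q"
  using assms lin_hom_compose[of "\<beta> _" K _ P f] lin_hom_compose[of "\<lambda>x. \<beta> x _" K _ P f]
  unfolding bilin_hom_def by blast


section \<open>The additive group of a tensor product\<close>

locale module_pair = M: module K M + N: module K N
  for K (structure) and M (structure) and N (structure)
begin

abbreviation pairs where "pairs \<equiv> carrier M \<times> carrier N"
abbreviation null where "null \<equiv> tensor_null K M N"
abbreviation cls where "cls \<equiv> tensor_class K M N"
abbreviation pure where "pure \<equiv> pure_tensor K M N"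
abbreviation T where "T \<equiv> tensor K M N"

lemma frag_of_keys: "z \<in> pairs \<Longrightarrow> Poly_Mapping.keys (frag_of z) \<subseteq> pairs"
  by (simp)

lemma keys_diff_subset:
  "\<lbrakk>Poly_Mapping.keys p \<subseteq> S; Poly_Mapping.keys q \<subseteq> S\<rbrakk> \<Longrightarrow> Poly_Mapping.keys (p - q) \<subseteq> S"
  by (meson Un_least keys_diff order_trans)

lemma keys_add_subset:
  "\<lbrakk>Poly_Mapping.keys p \<subseteq> S; Poly_Mapping.keys q \<subseteq> S\<rbrakk> \<Longrightarrow> Poly_Mapping.keys (p + q) \<subseteq> S"
  by (meson Un_least keys_add order_trans)

lemma tensor_rels_keys: "r \<in> tensor_rels K M N \<Longrightarrow> Poly_Mapping.keys r \<subseteq> pairs"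
  unfolding tensor_rels_def by (auto intro!: keys_diff_subset dest!: subsetD[OF keys_diff])

lemma null_subgroup: "subgroup null (free_Abelian_group pairs)"
  unfolding tensor_null_def
  by (rule group.generate_is_subgroup) (auto dest: tensor_rels_keys)

lemma null_keys: "p \<in> null \<Longrightarrow> Poly_Mapping.keys p \<subseteq> pairs"
  using subgroup.mem_carrier[OF null_subgroup, of p] by simp

lemma null_zero: "0 \<in> null"
  using subgroup.one_closed[OF null_subgroup] by simp

lemma null_uminus: "p \<in> null \<Longrightarrow> - p \<in> null"
  using subgroup.m_inv_closed[OF null_subgroup] null_keys by fastforce

lemma null_add: "\<lbrakk>p \<in> null; q \<in> null\<rbrakk> \<Longrightarrow> p + q \<in> null"
  using subgroup.m_closed[OF null_subgroup] by fastforce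

lemma null_diff: "\<lbrakk>p \<in> null; q \<in> null\<rbrakk> \<Longrightarrow> p - q \<in> null"
  using null_add[of p "- q"] null_uminus[of q] by simp

lemma
  shows null_left_add: "\<lbrakk>x \<in> carrier M; x' \<in> carrier M; y \<in> carrier N\<rbrakk> \<Longrightarrow>
      frag_of (x \<oplus>\<^bsub>M\<^esub> x', y) - frag_of (x, y) - frag_of (x', y) \<in> null"
    and null_right_add: "\<lbrakk>x \<in> carrier M; y \<in> carrier N; y' \<in> carrier N\<rbrakk> \<Longrightarrow>
      frag_of (x, y \<oplus>\<^bsub>N\<^esub> y') - frag_of (x, y) - frag_of (x, y') \<in> null"
    and null_balanced: "\<lbrakk>a \<in> carrier K; x \<in> carrier M; y \<in> carrier N\<rbrakk> \<Longrightarrow>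
      frag_of (a \<odot>\<^bsub>M\<^esub> x, y) - frag_of (x, a \<odot>\<^bsub>N\<^esub> y) \<in> null"
  unfolding tensor_null_def tensor_rels_def by (blast intro: generate.incl)+

text \<open>
  A difference of two relations is the only closure step to be checked, because sums and negatives
  are differences once \<open>0\<close> is available.
\<close>

lemma null_induct [consumes 1, case_names zero left_add right_add balanced diff]:
  assumes "p \<in> null"
    and zero: "P 0"
    and left: "\<And>x x' y. \<lbrakk>x \<in> carrier M; x' \<in> carrier M; y \<in> carrier N\<rbrakk> \<Longrightarrow>
      P (frag_of (x \<oplus>\<^bsub>M\<^esub> x', y) - frag_of (x, y) - frag_of (x', y))"
    and right: "\<And>x y y'. \<lbrakk>x \<in> carrier M; y \<in> carrier N; y' \<in> carrier N\<rbrakk> \<Longrightarrow>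
      P (frag_of (x, y \<oplus>\<^bsub>N\<^esub> y') - frag_of (x, y) - frag_of (x, y'))"
    and balanced: "\<And>a x y. \<lbrakk>a \<in> carrier K; x \<in> carrier M; y \<in> carrier N\<rbrakk> \<Longrightarrow>
      P (frag_of (a \<odot>\<^bsub>M\<^esub> x, y) - frag_of (x, a \<odot>\<^bsub>N\<^esub> y))"
    and diff: "\<And>p q. \<lbrakk>p \<in> null; q \<in> null; P p; P q\<rbrakk> \<Longrightarrow> P (p - q)"
  shows "P p"
proof -
  have rel: "P r" if "r \<in> tensor_rels K M N" for r
    using that left right balanced unfolding tensor_rels_def by auto
  have rel_null: "r \<in> null" if "r \<in> tensor_rels K M N" for r
    using that unfolding tensor_null_def by (rule generate.incl)
  from assms(1) have "p \<in> null \<and> P p"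
    unfolding tensor_null_def
  proof (induction rule: generate.induct)
    case one
    then show ?case using zero null_zero by (simp add: tensor_null_def)
  next
    case (incl h)
    then show ?case using rel rel_null by (simp add: tensor_null_def)
  next
    case (inv h)
    then have "h \<in> null" "P h" using rel rel_null by auto
    then have "P (0 - h)" "0 - h \<in> null" using diff zero null_zero null_diff by blast+
    then show ?case using inv tensor_rels_keys by (simp add: tensor_null_def)
  next
    case (eng h1 h2)
    then have h: "h1 \<in> null" "P h1" "h2 \<in> null" "P h2" by (auto simp: tensor_null_def)
    then have "P (h1 - (0 - h2))" "h1 - (0 - h2) \<in> null" 
      using diff zero null_zero null_diff by blast+
    then show ?case by (simp add: tensor_null_def)
  qed
  then show ?thesis ..
qed

lemma cls_eq_iff:
  assumes "Poly_Mapping.keys p \<subseteq> pairs" "Poly_Mapping.keys q \<subseteq> pairs"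
  shows "cls p = cls q \<longleftrightarrow> p - q \<in> null"
proof
  assume "cls p = cls q"
  moreover have "p \<in> cls p"
    unfolding tensor_class_def r_coset_def using null_zero by force
  ultimately have "p \<in> cls q" by simp
  then show "p - q \<in> null"
    unfolding tensor_class_def r_coset_def by auto
next
  assume "p - q \<in> null"
  then have "p \<in> null #>\<^bsub>free_Abelian_group pairs\<^esub> q"
    unfolding r_coset_def by force
  then show "cls p = cls q"
    unfolding tensor_class_def
    using group.repr_independence[OF group_free_Abelian_group _ _ null_subgroup] assms by force
qed

lemma mem_cls_iff:
  assumes "Poly_Mapping.keys q \<subseteq> pairs"
  shows "p \<in> cls q \<longleftrightarrow> Poly_Mapping.keys p \<subseteq> pairs \<and> cls p = cls q"
proof
  assume "p \<in> cls q"
  then obtain n where n: "n \<in> null" "p = n + q"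
    unfolding tensor_class_def r_coset_def by auto
  then have "Poly_Mapping.keys p \<subseteq> pairs" using assms by (simp add: null_keys keys_add_subset)
  then show "Poly_Mapping.keys p \<subseteq> pairs \<and> cls p = cls q"
    using n assms by (simp add: cls_eq_iff)
next
  assume "Poly_Mapping.keys p \<subseteq> pairs \<and> cls p = cls q"
  then have "p - q \<in> null" using assms cls_eq_iff by blast
  then show "p \<in> cls q" unfolding tensor_class_def r_coset_def by force
qed

lemma the_elem_image_cls:
  assumes "Poly_Mapping.keys p \<subseteq> pairs"
    and "\<And>q. \<lbrakk>Poly_Mapping.keys q \<subseteq> pairs; q - p \<in> null\<rbrakk> \<Longrightarrow> f q = f p"
  shows "the_elem (f ` cls p) = f p"
proof (rule the_elem_image_unique)
  show "cls p \<noteq> {}" using mem_cls_iff[OF assms(1), of p] assms(1) by blast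
  fix q assume "q \<in> cls p"
  then have "Poly_Mapping.keys q \<subseteq> pairs" "q - p \<in> null"
    using assms(1) by (simp_all add: mem_cls_iff flip: cls_eq_iff)
  then show "f q = f p" by (rule assms(2))
qed

lemma carrier_T: "carrier T = cls ` {p. Poly_Mapping.keys p \<subseteq> pairs}"
proof -
  have "carrier (free_Abelian_group pairs) = {p. Poly_Mapping.keys p \<subseteq> pairs}"
    by (simp add: free_Abelian_group_def)
  then show ?thesis
    by (simp add: tensor_def Let_def carrier_FactGroup tensor_class_def[abs_def])
qed

lemma cls_closed: "Poly_Mapping.keys p \<subseteq> pairs \<Longrightarrow> cls p \<in> carrier T"
  by (simp add: carrier_T)

lemma zero_T: "\<zero>\<^bsub>T\<^esub> = cls 0"
  unfolding tensor_class_def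
  using group.coset_mult_one[OF group_free_Abelian_group subgroup.subset[OF null_subgroup]]
  by (simp add: tensor_def Let_def)

lemma null_normal: "null \<lhd> free_Abelian_group pairs"
  using null_subgroup abelian_free_Abelian_group
  by (metis comm_group.normal_iff_subgroup)

lemma add_cls:
  "\<lbrakk>Poly_Mapping.keys p \<subseteq> pairs; Poly_Mapping.keys q \<subseteq> pairs\<rbrakk>
    \<Longrightarrow> cls p \<oplus>\<^bsub>T\<^esub> cls q = cls (p + q)"
  using normal.rcos_sum[OF null_normal, of p q]
  by (simp add: tensor_def Let_def tensor_class_def)

lemma abelian_group_T: "abelian_group T"
proof -
  let ?Q = "free_Abelian_group pairs Mod null"
  interpret Q: comm_group ?Q
    by (rule comm_group.abelian_FactGroup[OF abelian_free_Abelian_group null_subgroup])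
  have [simp]: "carrier T = carrier ?Q" "\<zero>\<^bsub>T\<^esub> = \<one>\<^bsub>?Q\<^esub>" "add T = monoid.mult ?Q"
    by (simp_all add: tensor_def Let_def)
  show ?thesis
  proof (rule abelian_groupI)
    fix x assume "x \<in> carrier T"
    then show "\<exists>y \<in> carrier T. y \<oplus>\<^bsub>T\<^esub> x = \<zero>\<^bsub>T\<^esub>"
      using Q.l_inv_ex by simp
  qed (simp_all add: Q.m_ac del: mult_FactGroup one_FactGroup)
qed

lemma pure_closed: "\<lbrakk>x \<in> carrier M; y \<in> carrier N\<rbrakk> \<Longrightarrow> pure x y \<in> carrier T"
  unfolding pure_tensor_def by (rule cls_closed) simp

lemma cls_eq_add:
  assumes "p - q - q' \<in> null" "Poly_Mapping.keys p \<subseteq> pairs" "Poly_Mapping.keys q \<subseteq> pairs"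
    "Poly_Mapping.keys q' \<subseteq> pairs"
  shows "cls p = cls q \<oplus>\<^bsub>T\<^esub> cls q'"
  using assms by (simp add: add_cls cls_eq_iff keys_add_subset diff_diff_eq)

lemma pure_add_left: "\<lbrakk>x \<in> carrier M; x' \<in> carrier M; y \<in> carrier N\<rbrakk>
    \<Longrightarrow> pure (x \<oplus>\<^bsub>M\<^esub> x') y = pure x y \<oplus>\<^bsub>T\<^esub> pure x' y"
  unfolding pure_tensor_def by (rule cls_eq_add) (simp_all add: null_left_add)

lemma pure_add_right: "\<lbrakk>x \<in> carrier M; y \<in> carrier N; y' \<in> carrier N\<rbrakk>
    \<Longrightarrow> pure x (y \<oplus>\<^bsub>N\<^esub> y') = pure x y \<oplus>\<^bsub>T\<^esub> pure x y'"
  unfolding pure_tensor_def by (rule cls_eq_add) (simp_all add: null_right_add)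

lemma pure_balanced: "\<lbrakk>a \<in> carrier K; x \<in> carrier M; y \<in> carrier N\<rbrakk>
    \<Longrightarrow> pure (a \<odot>\<^bsub>M\<^esub> x) y = pure x (a \<odot>\<^bsub>N\<^esub> y)"
  unfolding pure_tensor_def by (simp add: cls_eq_iff null_balanced)

text \<open>
  Pure tensors generate the tensor product already under addition: the negative of
  \<open>x \<otimes> y\<close> is the pure tensor \<open>(- x) \<otimes> y\<close>, and zero is \<open>0 \<otimes> 0\<close>.
  With this induction, laws of additive operations on tensors reduce to pure tensors, and
  representatives need not be mentioned any more.
\<close>

lemma tensor_induct [consumes 1, case_names pure add]:
  assumes t: "t \<in> carrier T"
    and pure: "\<And>x y. \<lbrakk>x \<in> carrier M; y \<in> carrier N\<rbrakk> \<Longrightarrow> P (pure x y)"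
    and add: "\<And>t u. \<lbrakk>t \<in> carrier T; u \<in> carrier T; P t; P u\<rbrakk> \<Longrightarrow> P (t \<oplus>\<^bsub>T\<^esub> u)"
  shows "P t"
proof -
  interpret T: abelian_group T by (rule abelian_group_T)
  have zero: "pure \<zero>\<^bsub>M\<^esub> y = \<zero>\<^bsub>T\<^esub>" if "y \<in> carrier N" for y
    using pure_add_left[of "\<zero>\<^bsub>M\<^esub>" "\<zero>\<^bsub>M\<^esub>" y] pure_closed that T.add.l_cancel_one' by force
  have P0: "P (cls 0)" using pure[of "\<zero>\<^bsub>M\<^esub>" "\<zero>\<^bsub>N\<^esub>"] zero by (simp add: zero_T)
  have uminus: "cls (- frag_of (x, y)) = pure (\<ominus>\<^bsub>M\<^esub> x) y"
    if "x \<in> carrier M" "y \<in> carrier N" for x y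
  proof -
    have "pure (\<ominus>\<^bsub>M\<^esub> x) y \<oplus>\<^bsub>T\<^esub> pure x y = \<zero>\<^bsub>T\<^esub>"
      using pure_add_left[of "\<ominus>\<^bsub>M\<^esub> x" x y] that zero by (simp add: M.M.l_neg)
    moreover have "cls (- frag_of (x, y)) \<oplus>\<^bsub>T\<^esub> pure x y = \<zero>\<^bsub>T\<^esub>"
      using that by (simp add: pure_tensor_def add_cls zero_T)
    ultimately show ?thesis
      using that T.minus_equality[of _ "pure x y"]
      by (metis M.M.a_inv_closed SigmaI cls_closed frag_of_keys keys_minus pure_closed)
  qed
  from t obtain p where p: "t = cls p" "Poly_Mapping.keys p \<subseteq> pairs" by (auto simp: carrier_T)
  \<comment> \<open>Differences of formal sums need the statement for negatives as well.\<close>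
  from p(2) have "P (cls p) \<and> P (cls (- p))"
  proof (induction p rule: free_Abelian_group_induct[consumes 1, case_names zero diff frag_of])
    case zero
    show ?case using P0 by simp
  next
    case (diff p q)
    have "P (cls p \<oplus>\<^bsub>T\<^esub> cls (- q))" "P (cls q \<oplus>\<^bsub>T\<^esub> cls (- p))"
      using diff by (auto intro!: add cls_closed)
    then show ?case using diff by (simp add: add_cls)
  next
    case (frag_of z)
    then show ?case using uminus pure by (cases z) (auto simp flip: pure_tensor_def)
  qed
  then show ?thesis using p by simp
qed

section \<open>The tensor product as a module\<close>

abbreviation scale where "scale a \<equiv> frag_extend (\<lambda>(x, y). frag_of (a \<odot>\<^bsub>M\<^esub> x, y))"

lemma keys_scale:
  "\<lbrakk>a \<in> carrier K; Poly_Mapping.keys p \<subseteq> pairs\<rbrakk> \<Longrightarrow> Poly_Mapping.keys (scale a p) \<subseteq> pairs"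
  by (rule order_trans[OF keys_frag_extend]) auto

text \<open>
  Scaling the first factor preserves the relations, so that it descends to classes. Only the
  balancedness relation uses the commutativity of \<open>K\<close>.
\<close>

lemma scale_null:
  assumes "a \<in> carrier K" "p \<in> null"
  shows "scale a p \<in> null"
  using assms(2)
proof (induction p rule: null_induct)
  case (left_add x x' y)
  then show ?case
    using assms(1) null_left_add[of "a \<odot>\<^bsub>M\<^esub> x" "a \<odot>\<^bsub>M\<^esub> x'" y]
    by (simp add: frag_extend_diff M.smult_r_distr)
next
  case (balanced b x y)
  then have "a \<odot>\<^bsub>M\<^esub> (b \<odot>\<^bsub>M\<^esub> x) = b \<odot>\<^bsub>M\<^esub> (a \<odot>\<^bsub>M\<^esub> x)"
    using assms(1) by (metis M.R.m_comm M.smult_assoc1)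
  then show ?case
    using balanced assms(1) null_balanced[of b "a \<odot>\<^bsub>M\<^esub> x" y] by (simp add: frag_extend_diff)
qed (use assms(1) in \<open>simp_all add: frag_extend_diff null_zero null_diff null_right_add\<close>)

lemma smult_cls:
  assumes "a \<in> carrier K" "Poly_Mapping.keys p \<subseteq> pairs"
  shows "a \<odot>\<^bsub>T\<^esub> cls p = cls (scale a p)"
proof -
  have "a \<odot>\<^bsub>T\<^esub> cls p = the_elem ((\<lambda>p. cls (scale a p)) ` cls p)"
    by (simp add: tensor_def Let_def)
  also have "\<dots> = cls (scale a p)"
    using assms scale_null
    by (intro the_elem_image_cls) (simp_all add: cls_eq_iff keys_scale flip: frag_extend_diff)
  finally show ?thesis .
qed

lemma smult_pure:
  "\<lbrakk>a \<in> carrier K; x \<in> carrier M; y \<in> carrier N\<rbrakk> \<Longrightarrow> a \<odot>\<^bsub>T\<^esub> pure x y = pure (a \<odot>\<^bsub>M\<^esub> x) y"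
  by (simp add: pure_tensor_def smult_cls)

lemma module_T: "module K T"
proof -
  interpret T: abelian_group T by (rule abelian_group_T)
  have closed: "a \<odot>\<^bsub>T\<^esub> t \<in> carrier T" if "a \<in> carrier K" "t \<in> carrier T" for a t
    using that by (auto simp: carrier_T smult_cls keys_scale)
  have r_distr: "a \<odot>\<^bsub>T\<^esub> (t \<oplus>\<^bsub>T\<^esub> u) = a \<odot>\<^bsub>T\<^esub> t \<oplus>\<^bsub>T\<^esub> a \<odot>\<^bsub>T\<^esub> u"
    if "a \<in> carrier K" "t \<in> carrier T" "u \<in> carrier T" for a t u
    using that 
    by (auto simp: carrier_T smult_cls keys_scale add_cls keys_add_subset frag_extend_add)
  have l_distr: "(a \<oplus> b) \<odot>\<^bsub>T\<^esub> t = a \<odot>\<^bsub>T\<^esub> t \<oplus>\<^bsub>T\<^esub> b \<odot>\<^bsub>T\<^esub> t"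
    if ab: "a \<in> carrier K" "b \<in> carrier K" and "t \<in> carrier T" for a b t
    using that(3)
    by (induction t rule: tensor_induct)
      (simp_all add: ab smult_pure M.smult_l_distr pure_add_left r_distr closed T.a_ac)
  have assoc: "(a \<otimes> b) \<odot>\<^bsub>T\<^esub> t = a \<odot>\<^bsub>T\<^esub> (b \<odot>\<^bsub>T\<^esub> t)"
    if ab: "a \<in> carrier K" "b \<in> carrier K" and "t \<in> carrier T" for a b t
    using that(3)
    by (induction t rule: tensor_induct)
      (simp_all add: ab smult_pure M.smult_assoc1 r_distr closed)
  have one: "\<one> \<odot>\<^bsub>T\<^esub> t = t" if "t \<in> carrier T" for t
    using that by (induction t rule: tensor_induct) (simp_all add: smult_pure r_distr closed)
  show ?thesis
    by (rule moduleI[OF M.R.is_cring abelian_group_T closed l_distr r_distr assoc one])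
qed

lemma pure_bilin: "pure \<in> bilin_hom K M N T"
  by (intro bilin_homI lin_homI)
    (simp_all add: pure_closed pure_add_left pure_add_right smult_pure pure_balanced)

end


section \<open>The universal property of the tensor product\<close>

text \<open>
  The extension of \<open>b\<close> to formal integer combinations; \<open>tensor_lift P \<beta>\<close> is this map for
  \<open>b = case_prod \<beta>\<close>, applied to an arbitrary representative.
\<close>

definition frag_eval :: "('p, 'z) ring_scheme \<Rightarrow> ('a \<Rightarrow> 'p) \<Rightarrow> ('a \<Rightarrow>\<^sub>0 int) \<Rightarrow> 'p"
  where "frag_eval P b p =
    (\<Oplus>\<^bsub>P\<^esub>z \<in> Poly_Mapping.keys p. [Poly_Mapping.lookup p z] \<cdot>\<^bsub>P\<^esub> b z)"

context abelian_group
begin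

lemma frag_eval_superset:
  assumes "finite S" "Poly_Mapping.keys p \<subseteq> S" "b \<in> S \<rightarrow> carrier G"
  shows "frag_eval G b p = (\<Oplus>z \<in> S. [Poly_Mapping.lookup p z] \<cdot> b z)"
  unfolding frag_eval_def
proof (rule add.finprod_mono_neutral_cong_left)
  show "[Poly_Mapping.lookup p z] \<cdot> b z = \<zero>" if "z \<in> S - Poly_Mapping.keys p" for z
    using that by (simp add: in_keys_iff add_pow_def)
qed (use assms in auto)

lemma frag_eval_closed:
  assumes "b \<in> Poly_Mapping.keys p \<rightarrow> carrier G"
  shows "frag_eval G b p \<in> carrier G"
  using assms unfolding frag_eval_def by (auto intro!: finsum_closed)

lemma frag_eval_frag_of: "b z \<in> carrier G \<Longrightarrow> frag_eval G b (frag_of z) = b z"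
  by (simp add: frag_eval_def keys_frag_of)

lemma frag_eval_add:
  assumes "b \<in> Poly_Mapping.keys p \<rightarrow> carrier G" "b \<in> Poly_Mapping.keys q \<rightarrow> carrier G"
  shows "frag_eval G b (p + q) = frag_eval G b p \<oplus> frag_eval G b q"
proof -
  let ?S = "Poly_Mapping.keys p \<union> Poly_Mapping.keys q"
  have b: "b \<in> ?S \<rightarrow> carrier G" using assms by auto
  have "frag_eval G b (p + q) = (\<Oplus>z \<in> ?S. [Poly_Mapping.lookup (p + q) z] \<cdot> b z)"
    using b keys_add[of p q] by (intro frag_eval_superset) simp_all
  also have "\<dots> = (\<Oplus>z \<in> ?S. [Poly_Mapping.lookup p z] \<cdot> b z \<oplus> [Poly_Mapping.lookup q z] \<cdot> b z)"
    using b by (intro add.finprod_cong') (auto simp: lookup_add add.int_pow_mult Pi_iff)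
  also have "\<dots> = (\<Oplus>z \<in> ?S. [Poly_Mapping.lookup p z] \<cdot> b z) \<oplus>
      (\<Oplus>z \<in> ?S. [Poly_Mapping.lookup q z] \<cdot> b z)"
    using b by (intro finsum_addf) auto
  also have "\<dots> = frag_eval G b p \<oplus> frag_eval G b q"
    using b frag_eval_superset[of ?S p b] frag_eval_superset[of ?S q b] by simp
  finally show ?thesis .
qed

lemma frag_eval_diff:
  assumes "Poly_Mapping.keys p \<subseteq> S" "Poly_Mapping.keys q \<subseteq> S" "b \<in> S \<rightarrow> carrier G"
  shows "frag_eval G b (p - q) = frag_eval G b p \<ominus> frag_eval G b q"
proof -
  have b: "b \<in> Poly_Mapping.keys (p - q) \<rightarrow> carrier G" "b \<in> Poly_Mapping.keys q \<rightarrow> carrier G"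
    "b \<in> Poly_Mapping.keys p \<rightarrow> carrier G"
    using assms keys_diff[of p q] by auto
  then have "frag_eval G b p = frag_eval G b (p - q) \<oplus> frag_eval G b q"
    using frag_eval_add[of b "p - q" q] by simp
  then show ?thesis
    using b by (simp add: frag_eval_closed a_minus_def a_assoc r_neg)
qed

end

context module_pair
begin

context
  fixes P (structure) and \<beta>
  assumes P: "module K P" and \<beta>: "\<beta> \<in> bilin_hom K M N P"
begin

interpretation P: module K P by (rule P)

lemma \<beta>_closed: "\<lbrakk>x \<in> carrier M; y \<in> carrier N\<rbrakk> \<Longrightarrow> \<beta> x y \<in> carrier P"
  using \<beta> by (rule bilin_hom_closed)

lemma \<beta>_pairs: "Poly_Mapping.keys p \<subseteq> pairs \<Longrightarrow> case_prod \<beta> \<in> Poly_Mapping.keys p \<rightarrow> carrier P"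
  by (force intro: \<beta>_closed)

lemma eval_diff:
  "\<lbrakk>Poly_Mapping.keys p \<subseteq> pairs; Poly_Mapping.keys q \<subseteq> pairs\<rbrakk> \<Longrightarrow>
    frag_eval P (case_prod \<beta>) (p - q) = frag_eval P (case_prod \<beta>) p \<ominus>\<^bsub>P\<^esub> frag_eval P (case_prod \<beta>) q"
  by (rule P.frag_eval_diff) (auto intro: \<beta>_closed)

lemma eval_of:
  "\<lbrakk>x \<in> carrier M; y \<in> carrier N\<rbrakk> \<Longrightarrow> frag_eval P (case_prod \<beta>) (frag_of (x, y)) = \<beta> x y"
  by (simp add: P.frag_eval_frag_of \<beta>_closed)

text \<open>
  Additivity in each argument kills the first two kinds of relations; linearity in both arguments
  gives \<open>\<beta> (a x) y = a \<beta> x y = \<beta> x (a y)\<close>, which kills the third.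
\<close>

lemma eval_null: "p \<in> null \<Longrightarrow> frag_eval P (case_prod \<beta>) p = \<zero>\<^bsub>P\<^esub>"
proof (induction p rule: null_induct)
  case zero
  show ?case by (simp add: frag_eval_def)
next
  case (left_add x x' y)
  then show ?case
    using lin_hom_add[OF bilin_hom_left[OF \<beta>], of y x x']
    by (simp add: eval_diff eval_of keys_diff_subset \<beta>_closed P.M.minus_eq P.M.minus_add
        P.M.a_ac P.M.r_neg P.M.r_neg1 P.M.r_neg2)
next
  case (right_add x y y')
  then show ?case
    using lin_hom_add[OF bilin_hom_right[OF \<beta>], of x y y']
    by (simp add: eval_diff eval_of keys_diff_subset \<beta>_closed P.M.minus_eq P.M.minus_add
        P.M.a_ac P.M.r_neg P.M.r_neg1 P.M.r_neg2)
next
  case (balanced a x y)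
  then show ?case
    using lin_hom_smult[OF bilin_hom_left[OF \<beta>], of y a x]
      lin_hom_smult[OF bilin_hom_right[OF \<beta>], of x a y]
    by (simp add: eval_diff eval_of \<beta>_closed P.M.minus_eq P.M.r_neg)
next
  case (diff p q)
  then show ?case by (simp add: eval_diff null_keys P.M.minus_eq)
qed

lemma tensor_lift_cls:
  assumes p: "Poly_Mapping.keys p \<subseteq> pairs"
  shows "tensor_lift P \<beta> (cls p) = frag_eval P (case_prod \<beta>) p"
proof -
  have "tensor_lift P \<beta> (cls p) = the_elem (frag_eval P (case_prod \<beta>) ` cls p)"
    unfolding tensor_lift_def frag_eval_def ..
  also have "\<dots> = frag_eval P (case_prod \<beta>) p"
  proof (rule the_elem_image_cls[OF p])
    fix q assume q: "Poly_Mapping.keys q \<subseteq> pairs" "q - p \<in> null"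
    then have "frag_eval P (case_prod \<beta>) (p + (q - p)) =
        frag_eval P (case_prod \<beta>) p \<oplus>\<^bsub>P\<^esub> frag_eval P (case_prod \<beta>) (q - p)"
      using p by (intro P.frag_eval_add \<beta>_pairs keys_diff_subset)
    then show "frag_eval P (case_prod \<beta>) q = frag_eval P (case_prod \<beta>) p"
      using eval_null[OF q(2)] P.frag_eval_closed[OF \<beta>_pairs[OF p]] by simp
  qed
  finally show ?thesis .
qed

lemma tensor_lift_pure:
  "\<lbrakk>x \<in> carrier M; y \<in> carrier N\<rbrakk> \<Longrightarrow> tensor_lift P \<beta> (pure x y) = \<beta> x y"
  by (simp add: pure_tensor_def tensor_lift_cls eval_of)

lemma tensor_lift_linear: "tensor_lift P \<beta> \<in> lin_hom K T P"
proof -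
  interpret T: module K T by (rule module_T)
  have closed: "tensor_lift P \<beta> t \<in> carrier P" if "t \<in> carrier T" for t
  proof -
    from that obtain p where p: "t = cls p" "Poly_Mapping.keys p \<subseteq> pairs" by (auto simp: carrier_T)
    then show ?thesis using P.frag_eval_closed[OF \<beta>_pairs[OF p(2)]] by (simp add: tensor_lift_cls)
  qed
  have lift_add: "tensor_lift P \<beta> (t \<oplus>\<^bsub>T\<^esub> u) = tensor_lift P \<beta> t \<oplus>\<^bsub>P\<^esub> tensor_lift P \<beta> u"
    if "t \<in> carrier T" "u \<in> carrier T" for t u
    using that
    by (auto simp: carrier_T add_cls tensor_lift_cls keys_add_subset P.frag_eval_add \<beta>_pairs)
  have "tensor_lift P \<beta> (a \<odot>\<^bsub>T\<^esub> t) = a \<odot>\<^bsub>P\<^esub> tensor_lift P \<beta> t"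
    if a: "a \<in> carrier K" and "t \<in> carrier T" for a t
    using that(2)
  proof (induction t rule: tensor_induct)
    case (pure x y)
    then show ?case
      using a lin_hom_smult[OF bilin_hom_left[OF \<beta>], of y a x]
      by (simp add: smult_pure tensor_lift_pure)
  next
    case (add t u)
    then show ?case
      using a by (simp add: T.smult_r_distr P.smult_r_distr closed lift_add)
  qed
  then show ?thesis using closed lift_add by (intro lin_homI)
qed

end

lemma
  assumes "f \<in> lin_hom K A M" "g \<in> lin_hom K B N" "module K A" "module K B"
  shows tensor_map_linear: "tensor_map K M N f g \<in> lin_hom K (tensor K A B) T"
    and tensor_map_pure: "\<lbrakk>x \<in> carrier A; y \<in> carrier B\<rbrakk> \<Longrightarrow>
      tensor_map K M N f g (pure_tensor K A B x y) = pure (f x) (g y)"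
proof -
  interpret AB: module_pair K A B by (intro module_pair.intro assms)
  have "(\<lambda>x y. pure (f x) (g y)) \<in> bilin_hom K A B T"
    by (rule bilin_hom_compose[OF assms(1,2) pure_bilin])
  then show "tensor_map K M N f g \<in> lin_hom K (tensor K A B) T"
    and "\<lbrakk>x \<in> carrier A; y \<in> carrier B\<rbrakk> \<Longrightarrow>
      tensor_map K M N f g (pure_tensor K A B x y) = pure (f x) (g y)"
    unfolding tensor_map_def
    by (simp_all add: AB.tensor_lift_linear AB.tensor_lift_pure module_T)
qed

end

text \<open>
  The associator is a lift of lifts. The inner lift is linear in its tensor argument by the universal
  property of \<open>M \<otimes> N\<close>; its linearity in \<open>z\<close> is checked on pure tensors. Hence it is bilinear
  and the universal property of \<open>(M \<otimes> N) \<otimes> P\<close> applies.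
\<close>

lemma
  assumes M: "module K M" and N: "module K N" and P: "module K P"
  shows tensor_assoc_linear: "tensor_assoc K M N P \<in>
      lin_hom K (tensor K (tensor K M N) P) (tensor K M (tensor K N P))"
    and tensor_assoc_pure: "\<lbrakk>x \<in> carrier M; y \<in> carrier N; z \<in> carrier P\<rbrakk> \<Longrightarrow>
      tensor_assoc K M N P (pure_tensor K (tensor K M N) P (pure_tensor K M N x y) z) =
      pure_tensor K M (tensor K N P) x (pure_tensor K N P y z)"
proof -
  interpret MN: module_pair K M N by (intro module_pair.intro assms)
  interpret NP: module_pair K N P by (intro module_pair.intro assms)
  interpret L: module_pair K MN.T P by (intro module_pair.intro MN.module_T P)
  interpret R: module_pair K M NP.T by (intro module_pair.intro NP.module_T M)
  interpret RT: module K R.T by (rule R.module_T)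
  let ?b = "\<lambda>z x y. R.pure x (NP.pure y z)"
  let ?l = "\<lambda>t z. tensor_lift R.T (?b z) t"
  have b: "?b z \<in> bilin_hom K M N R.T" if "z \<in> carrier P" for z
    by (rule bilin_hom_compose[OF lin_hom_id bilin_hom_left[OF NP.pure_bilin that] R.pure_bilin,
          unfolded id_apply])
  have lin_l: "(\<lambda>t. ?l t z) \<in> lin_hom K MN.T R.T" if "z \<in> carrier P" for z
    by (rule MN.tensor_lift_linear[OF R.module_T b[OF that]])
  have l_pure: "?l (MN.pure x y) z = R.pure x (NP.pure y z)"
    if "x \<in> carrier M" "y \<in> carrier N" "z \<in> carrier P" for x y z
    using that by (simp add: MN.tensor_lift_pure[OF R.module_T b])
  have lin_z: "(\<lambda>z. R.pure x (NP.pure y z)) \<in> lin_hom K P R.T"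
    if "x \<in> carrier M" "y \<in> carrier N" for x y
    using that by (intro lin_hom_compose[OF bilin_hom_right[OF NP.pure_bilin]
          bilin_hom_right[OF R.pure_bilin]])
  have closed: "?l t z \<in> carrier R.T" if "t \<in> carrier MN.T" "z \<in> carrier P" for t z
    by (rule lin_hom_closed[OF lin_l[OF that(2)] that(1)])
  note l_add = lin_hom_add[OF lin_l]
  have "?l \<in> bilin_hom K MN.T P R.T"
  proof (rule bilin_homI)
    fix t assume t: "t \<in> carrier MN.T"
    show "?l t \<in> lin_hom K P R.T"
    proof (rule lin_homI)
      fix z assume "z \<in> carrier P"
      then show "?l t z \<in> carrier R.T" using t closed by blast
    next
      fix z z' assume z: "z \<in> carrier P" "z' \<in> carrier P"
      show "?l t (z \<oplus>\<^bsub>P\<^esub> z') = ?l t z \<oplus>\<^bsub>R.T\<^esub> ?l t z'"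
        using t
      proof (induction t rule: MN.tensor_induct)
        case (pure x y)
        then show ?case using z lin_hom_add[OF lin_z] by (simp add: l_pure)
      next
        case (add t u)
        then show ?case using z by (simp add: l_add closed RT.M.a_ac)
      qed
    next
      fix a z assume a: "a \<in> carrier K" "z \<in> carrier P"
      show "?l t (a \<odot>\<^bsub>P\<^esub> z) = a \<odot>\<^bsub>R.T\<^esub> ?l t z"
        using t
      proof (induction t rule: MN.tensor_induct)
        case (pure x y)
        then show ?case using a lin_hom_smult[OF lin_z] by (simp add: l_pure)
      next
        case (add t u)
        then show ?case using a by (simp add: l_add closed RT.smult_r_distr)
      qed
    qed
  next
    fix z assume "z \<in> carrier P"
    then show "(\<lambda>t. ?l t z) \<in> lin_hom K MN.T R.T" by (rule lin_l)
  qed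
  note l = R.module_T this
  have eq: "tensor_assoc K M N P = tensor_lift R.T ?l"
    by (simp add: tensor_assoc_def Let_def)
  show "tensor_assoc K M N P \<in> lin_hom K L.T R.T"
    unfolding eq by (rule L.tensor_lift_linear[OF l])
  show "tensor_assoc K M N P (L.pure (MN.pure x y) z) = R.pure x (NP.pure y z)"
    if "x \<in> carrier M" "y \<in> carrier N" "z \<in> carrier P"
    using that unfolding eq by (simp add: L.tensor_lift_pure[OF l] MN.pure_closed l_pure)
qed


section \<open>The product of a tensor product of algebras\<close>

lemma frag_extend_fun_diff: "frag_extend (\<lambda>z. f z - h z) q = frag_extend f q - frag_extend h q"
proof -
  have "Poly_Mapping.keys q \<subseteq> UNIV" by simp
  then show ?thesis by (induction q rule: frag_induction) (simp_all add: frag_extend_diff)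
qed

locale algebra_pair = M: assoc_algebra K M + N: assoc_algebra K N
  for K (structure) and M (structure) and N (structure)

sublocale algebra_pair \<subseteq> module_pair ..

context algebra_pair
begin

abbreviation cross where "cross p q \<equiv>
  frag_extend (\<lambda>(x, y). frag_extend (\<lambda>(x', y'). frag_of (x \<otimes>\<^bsub>M\<^esub> x', y \<otimes>\<^bsub>N\<^esub> y')) q) p"

text \<open>
  Exchanging the order of the two extensions makes additivity in the second argument as immediate
  as additivity in the first, and reduces both parts of well-definedness to the same computation
  with a single pure tensor on one side.
\<close>

lemma cross_swap: "cross p q =
  frag_extend (\<lambda>(x', y'). frag_extend (\<lambda>(x, y). frag_of (x \<otimes>\<^bsub>M\<^esub> x', y \<otimes>\<^bsub>N\<^esub> y')) p) q"
proof -
  have "Poly_Mapping.keys p \<subseteq> UNIV" by simp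
  then show ?thesis
  proof (induction p rule: frag_induction)
    case zero
    then show ?case by (simp add: frag_extend_eq_0 split_def)
  next
    case (one z)
    then show ?case by (simp add: split_def)
  next
    case (diff p p')
    then show ?case by (simp add: frag_extend_diff split_def frag_extend_fun_diff)
  qed
qed

lemma cross_diff_left: "cross (p - p') q = cross p q - cross p' q"
  by (rule frag_extend_diff)

lemma cross_diff_right: "cross p (q - q') = cross p q - cross p q'"
  unfolding cross_swap by (rule frag_extend_diff)

lemma keys_cross:
  assumes "Poly_Mapping.keys p \<subseteq> pairs" "Poly_Mapping.keys q \<subseteq> pairs"
  shows "Poly_Mapping.keys (cross p q) \<subseteq> pairs"
  using assms by (fastforce dest!: subsetD[OF keys_frag_extend])

lemma cross_null_right:
  assumes "Poly_Mapping.keys p \<subseteq> pairs" "q \<in> null"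
  shows "cross p q \<in> null"
  using assms(1)
proof (induction p rule: frag_induction)
  case (one z)
  obtain x y where z: "z = (x, y)" "x \<in> carrier M" "y \<in> carrier N" using one by auto
  from assms(2) show ?case
  proof (induction q rule: null_induct)
    case (left_add u u' v)
    then show ?case using z null_left_add[of "x \<otimes>\<^bsub>M\<^esub> u" "x \<otimes>\<^bsub>M\<^esub> u'" "y \<otimes>\<^bsub>N\<^esub> v"]
      by (simp add: frag_extend_diff M.r_distr)
  next
    case (right_add u v v')
    then show ?case using z null_right_add[of "x \<otimes>\<^bsub>M\<^esub> u" "y \<otimes>\<^bsub>N\<^esub> v" "y \<otimes>\<^bsub>N\<^esub> v'"]
      by (simp add: frag_extend_diff N.r_distr)
  next
    case (balanced a u v)
    then show ?case using z null_balanced[of a "x \<otimes>\<^bsub>M\<^esub> u" "y \<otimes>\<^bsub>N\<^esub> v"]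
      by (simp add: frag_extend_diff M.smult_mult_right N.smult_mult_right)
  qed (simp_all add: z null_zero null_diff frag_extend_diff)
qed (simp_all add: null_zero null_diff frag_extend_diff)

lemma cross_null_left:
  assumes "p \<in> null" "Poly_Mapping.keys q \<subseteq> pairs"
  shows "cross p q \<in> null"
  using assms(2) unfolding cross_swap
proof (induction q rule: frag_induction)
  case (one z)
  obtain x y where z: "z = (x, y)" "x \<in> carrier M" "y \<in> carrier N" using one by auto
  from assms(1) show ?case
  proof (induction p rule: null_induct)
    case (left_add u u' v)
    then show ?case using z null_left_add[of "u \<otimes>\<^bsub>M\<^esub> x" "u' \<otimes>\<^bsub>M\<^esub> x" "v \<otimes>\<^bsub>N\<^esub> y"]
      by (simp add: frag_extend_diff M.l_distr)
  next
    case (right_add u v v')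
    then show ?case using z null_right_add[of "u \<otimes>\<^bsub>M\<^esub> x" "v \<otimes>\<^bsub>N\<^esub> y" "v' \<otimes>\<^bsub>N\<^esub> y"]
      by (simp add: frag_extend_diff N.l_distr)
  next
    case (balanced a u v)
    then show ?case using z null_balanced[of a "u \<otimes>\<^bsub>M\<^esub> x" "v \<otimes>\<^bsub>N\<^esub> y"]
      by (simp add: frag_extend_diff M.smult_mult_left N.smult_mult_left)
  qed (simp_all add: z null_zero null_diff frag_extend_diff)
qed (simp_all add: null_zero null_diff frag_extend_diff)

lemma mult_cls:
  assumes p: "Poly_Mapping.keys p \<subseteq> pairs" and q: "Poly_Mapping.keys q \<subseteq> pairs"
  shows "cls p \<otimes>\<^bsub>T\<^esub> cls q = cls (cross p q)"
proof -
  have "cls (cross p' q') = cls (cross p q)" if "p' \<in> cls p" "q' \<in> cls q" for p' q'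
  proof -
    have p': "Poly_Mapping.keys p' \<subseteq> pairs" "p' - p \<in> null"
      and q': "Poly_Mapping.keys q' \<subseteq> pairs" "q' - q \<in> null"
      using that p q by (simp_all add: mem_cls_iff flip: cls_eq_iff)
    have "cross p' q' - cross p q = cross (p' - p) q' + cross p (q' - q)"
      by (simp only: cross_diff_left cross_diff_right) simp
    also have "\<dots> \<in> null"
      using p p' q' by (intro null_add cross_null_left cross_null_right)
    finally show ?thesis using p q p' q' by (simp add: cls_eq_iff keys_cross)
  qed
  moreover have "p \<in> cls p" "q \<in> cls q" using p q by (simp_all add: mem_cls_iff)
  ultimately have "{cls (cross p' q') | p' q'. p' \<in> cls p \<and> q' \<in> cls q} = {cls (cross p q)}"
    by blast
  then show ?thesis by (simp add: tensor_def Let_def)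
qed

lemma mult_pure:
  "\<lbrakk>x \<in> carrier M; y \<in> carrier N; x' \<in> carrier M; y' \<in> carrier N\<rbrakk> \<Longrightarrow>
    pure x y \<otimes>\<^bsub>T\<^esub> pure x' y' = pure (x \<otimes>\<^bsub>M\<^esub> x') (y \<otimes>\<^bsub>N\<^esub> y')"
  by (simp add: pure_tensor_def mult_cls)

lemma mult_bilin: "monoid.mult T \<in> bilin_hom K T T T"
proof -
  interpret T: module K T by (rule module_T)
  have closed: "t \<otimes>\<^bsub>T\<^esub> u \<in> carrier T" if "t \<in> carrier T" "u \<in> carrier T" for t u
  proof -
    from that obtain p q where "t = cls p" "u = cls q"
      and "Poly_Mapping.keys p \<subseteq> pairs" "Poly_Mapping.keys q \<subseteq> pairs"
      by (auto simp: carrier_T)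
    then show ?thesis by (simp add: mult_cls cls_closed keys_cross)
  qed
  have add_left: "(t \<oplus>\<^bsub>T\<^esub> t') \<otimes>\<^bsub>T\<^esub> u = t \<otimes>\<^bsub>T\<^esub> u \<oplus>\<^bsub>T\<^esub> t' \<otimes>\<^bsub>T\<^esub> u"
    if "t \<in> carrier T" "t' \<in> carrier T" "u \<in> carrier T" for t t' u
  proof -
    from that obtain p p' q where "t = cls p" "t' = cls p'" "u = cls q"
      and k: "Poly_Mapping.keys p \<subseteq> pairs" "Poly_Mapping.keys p' \<subseteq> pairs"
        "Poly_Mapping.keys q \<subseteq> pairs"
      by (auto simp: carrier_T)
    then show ?thesis
      by (simp add: add_cls mult_cls keys_add_subset keys_cross frag_extend_add)
  qed
  have add_right: "u \<otimes>\<^bsub>T\<^esub> (t \<oplus>\<^bsub>T\<^esub> t') = u \<otimes>\<^bsub>T\<^esub> t \<oplus>\<^bsub>T\<^esub> u \<otimes>\<^bsub>T\<^esub> t'"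
    if "t \<in> carrier T" "t' \<in> carrier T" "u \<in> carrier T" for t t' u
  proof -
    from that obtain p p' q where "t = cls p" "t' = cls p'" "u = cls q"
      and k: "Poly_Mapping.keys p \<subseteq> pairs" "Poly_Mapping.keys p' \<subseteq> pairs"
        "Poly_Mapping.keys q \<subseteq> pairs"
      by (auto simp: carrier_T)
    moreover have "cross q (p + p') = cross q p + cross q p'"
      unfolding cross_swap by (rule frag_extend_add)
    ultimately show ?thesis
      by (simp add: add_cls mult_cls keys_add_subset keys_cross)
  qed
  (* No representatives here: by additivity it suffices to multiply pure tensors. *)
  have smult: "(a \<odot>\<^bsub>T\<^esub> t) \<otimes>\<^bsub>T\<^esub> u = a \<odot>\<^bsub>T\<^esub> (t \<otimes>\<^bsub>T\<^esub> u) \<and> t \<otimes>\<^bsub>T\<^esub> (a \<odot>\<^bsub>T\<^esub> u) = a \<odot>\<^bsub>T\<^esub> (t \<otimes>\<^bsub>T\<^esub> u)"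
    if a: "a \<in> carrier K" and t: "t \<in> carrier T" and u: "u \<in> carrier T" for a t u
    using t
  proof (induction t rule: tensor_induct)
    case (pure x y)
    note xy = pure
    from u show ?case
    proof (induction u rule: tensor_induct)
      case (pure x' y')
      then show ?case
        using a xy by (simp add: smult_pure mult_pure M.smult_mult_left M.smult_mult_right)
    next
      case (add u u')
      then show ?case
        using a xy by (simp add: add_right T.smult_r_distr closed pure_closed)
    qed
  next
    case (add t t')
    then show ?case
      using a u by (simp add: add_left T.smult_r_distr closed)
  qed
  show ?thesis
    by (intro bilin_homI lin_homI) (simp_all add: closed add_left add_right smult)
qed

end


section \<open>The group algebra as a free module\<close>

text \<open>
  All structures are studied on the single record \<open>group_hopf_algebra K G\<close>, since a finite sum
  in a module depends only on the carrier, the addition and the zero, not on the other fields.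
\<close>

locale field_group = K: field K + G: group G
  for K :: "('k, 'r) ring_scheme" (structure) and G :: "('g, 's) monoid_scheme" (structure)
begin

abbreviation H :: "('k, 'g \<Rightarrow> 'k) hopf_algebra" where "H \<equiv> group_hopf_algebra K G"
abbreviation e :: "'g \<Rightarrow> 'g \<Rightarrow> 'k" where "e \<equiv> group_elem K"

lemma carrier_H: "carrier H = {f \<in> UNIV \<rightarrow> carrier K. finite (supp K f) \<and> supp K f \<subseteq> carrier G}"
  by (simp add: group_hopf_algebra_def group_algebra_def Let_def)

lemma
  shows zero_H: "\<zero>\<^bsub>H\<^esub> = (\<lambda>x. \<zero>)"
    and add_H: "f \<oplus>\<^bsub>H\<^esub> f' = (\<lambda>x. f x \<oplus> f' x)"
    and smult_H: "a \<odot>\<^bsub>H\<^esub> f = (\<lambda>x. a \<otimes> f x)"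
    and one_H: "\<one>\<^bsub>H\<^esub> = e \<one>\<^bsub>G\<^esub>"
    and mult_H: "f \<otimes>\<^bsub>H\<^esub> f' =
      (\<lambda>x. \<Oplus>g \<in> supp K f. \<Oplus>h \<in> {h \<in> supp K f'. g \<otimes>\<^bsub>G\<^esub> h = x}. f g \<otimes> f' h)"
  by (simp_all add: group_hopf_algebra_def group_algebra_def Let_def group_elem_def)

lemma H_D:
  assumes "f \<in> carrier H"
  shows "f x \<in> carrier K" "finite (supp K f)" "supp K f \<subseteq> carrier G"
  using assms by (auto simp: carrier_H)

lemma H_I:
  assumes "\<And>x. f x \<in> carrier K" "supp K f \<subseteq> S" "finite S" "S \<subseteq> carrier G"
  shows "f \<in> carrier H"
  using assms by (auto simp: carrier_H intro: finite_subset)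

lemma e_closed: "g \<in> carrier G \<Longrightarrow> e g \<in> carrier H"
  by (rule H_I[of _ "{g}"]) (auto simp: group_elem_def supp_def)

lemma supp_e: "supp K (e g) = {g}"
  by (auto simp: group_elem_def supp_def)

lemma e_same: "e g g = \<one>"
  by (simp add: group_elem_def)

lemma e_inject: "e g = e h \<longleftrightarrow> g = h"
  using supp_e by (metis singleton_inject)

lemma add_closed_H: "f \<oplus>\<^bsub>H\<^esub> f' \<in> carrier H" if "f \<in> carrier H" "f' \<in> carrier H"
  using H_D[OF that(1)] H_D[OF that(2)]
  by (intro H_I[of _ "supp K f \<union> supp K f'"]) (auto simp: add_H supp_def)

lemma smult_closed_H: "a \<odot>\<^bsub>H\<^esub> f \<in> carrier H" if "a \<in> carrier K" "f \<in> carrier H"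
  using that(1) H_D[OF that(2)]
  by (intro H_I[of _ "supp K f"]) (auto simp: smult_H supp_def)

lemma module_H: "module K H"
proof (rule moduleI)
  show "abelian_group H"
  proof (rule abelian_groupI)
    show "\<zero>\<^bsub>H\<^esub> \<in> carrier H" by (rule H_I[of _ "{}"]) (auto simp: zero_H supp_def)
    fix f assume f: "f \<in> carrier H"
    have "(\<lambda>x. \<ominus> f x) \<in> carrier H"
      using H_D[OF f] by (intro H_I[of _ "supp K f"]) (auto simp: supp_def)
    moreover have "(\<lambda>x. \<ominus> f x) \<oplus>\<^bsub>H\<^esub> f = \<zero>\<^bsub>H\<^esub>"
      using H_D[OF f] by (simp add: add_H zero_H K.l_neg)
    ultimately show "\<exists>f' \<in> carrier H. f' \<oplus>\<^bsub>H\<^esub> f = \<zero>\<^bsub>H\<^esub>" by blast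
  qed (use H_D(1) in \<open>auto simp: add_closed_H, auto simp: add_H zero_H K.a_ac\<close>)
qed (use H_D(1) in \<open>auto simp: smult_closed_H K.is_cring,
  auto simp: add_H smult_H K.l_distr K.r_distr K.m_assoc\<close>)

sublocale H: module K H by (rule module_H)

text \<open>
  The group elements span: an element whose support lies in \<open>S \<union> {g}\<close> splits into a part with
  support in \<open>S\<close> and a multiple of the basis vector of \<open>g\<close>.
\<close>

lemma basis_induct [consumes 1, case_names zero add basis]:
  assumes f: "f \<in> carrier H"
    and zero: "P \<zero>\<^bsub>H\<^esub>"
    and add: "\<And>f f'. \<lbrakk>f \<in> carrier H; f' \<in> carrier H; P f; P f'\<rbrakk> \<Longrightarrow> P (f \<oplus>\<^bsub>H\<^esub> f')"
    and basis: "\<And>a g. \<lbrakk>a \<in> carrier K; g \<in> carrier G\<rbrakk> \<Longrightarrow> P (a \<odot>\<^bsub>H\<^esub> e g)"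
  shows "P f"
proof -
  have "P f" if "finite S" "supp K f \<subseteq> S" "S \<subseteq> carrier G" "f \<in> carrier H" for S f
    using that
  proof (induction S arbitrary: f rule: finite_induct)
    case empty
    then have "f = \<zero>\<^bsub>H\<^esub>" by (auto simp: supp_def zero_H)
    then show ?case using zero by simp
  next
    case (insert g S)
    note f = H_D[OF insert.prems(3)]
    define f0 where "f0 = f(g := \<zero>)"
    have supp: "supp K f0 \<subseteq> S"
      using insert.prems(1) by (auto simp: supp_def f0_def split: if_splits)
    have closed: "f0 \<in> carrier H"
      using supp insert f by (intro H_I[of _ S]) (auto simp: f0_def)
    have "f = f0 \<oplus>\<^bsub>H\<^esub> f g \<odot>\<^bsub>H\<^esub> e g"
      using f by (auto simp: add_H smult_H group_elem_def f0_def)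
    moreover have "P (f0 \<oplus>\<^bsub>H\<^esub> f g \<odot>\<^bsub>H\<^esub> e g)"
      using supp closed insert f
      by (intro add basis insert.IH) (auto intro!: smult_closed_H e_closed)
    ultimately show ?case by simp
  qed
  then show ?thesis using f H_D[OF f] by blast
qed

lemma lin_hom_zero:
  assumes "\<phi> \<in> lin_hom K H P" "module K P"
  shows "\<phi> \<zero>\<^bsub>H\<^esub> = \<zero>\<^bsub>P\<^esub>"
proof -
  interpret P: module K P by fact
  have "\<phi> (\<zero> \<odot>\<^bsub>H\<^esub> \<zero>\<^bsub>H\<^esub>) = \<zero> \<odot>\<^bsub>P\<^esub> \<phi> \<zero>\<^bsub>H\<^esub>"
    by (rule lin_hom_smult[OF assms(1)]) simp_all
  then show ?thesis using lin_hom_closed[OF assms(1), of "\<zero>\<^bsub>H\<^esub>"] by simp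
qed

text \<open>
  The Hopf algebra axioms and the averaging identities compare maps that are linear in each argument;
  by this uniqueness they need only be checked on group elements.
\<close>

lemma lin_hom_basis_ext:
  assumes "\<phi> \<in> lin_hom K H P" "\<psi> \<in> lin_hom K H P" "module K P"
    and "\<And>g. g \<in> carrier G \<Longrightarrow> \<phi> (e g) = \<psi> (e g)"
    and "f \<in> carrier H"
  shows "\<phi> f = \<psi> f"
  using assms(5)
proof (induction f rule: basis_induct)
  case zero
  show ?case using assms by (simp add: lin_hom_zero)
next
  case (add f f')
  then show ?case by (simp add: lin_hom_add[OF assms(1)] lin_hom_add[OF assms(2)])
next
  case (basis a g)
  then show ?case
    by (simp add: lin_hom_smult[OF assms(1)] lin_hom_smult[OF assms(2)] e_closed assms(4))
qed

lemma bilin_hom_basis_ext: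
  assumes "\<beta> \<in> bilin_hom K H H P" "\<gamma> \<in> bilin_hom K H H P" "module K P"
    and "\<And>g h. \<lbrakk>g \<in> carrier G; h \<in> carrier G\<rbrakk> \<Longrightarrow> \<beta> (e g) (e h) = \<gamma> (e g) (e h)"
    and "f \<in> carrier H" "f' \<in> carrier H"
  shows "\<beta> f f' = \<gamma> f f'"
proof -
  have "\<beta> (e g) f' = \<gamma> (e g) f'" if "g \<in> carrier G" for g
    using bilin_hom_right[OF assms(1) e_closed[OF that]]
      bilin_hom_right[OF assms(2) e_closed[OF that]] assms(3) assms(4)[OF that] assms(6)
    by (rule lin_hom_basis_ext)
  with bilin_hom_left[OF assms(1,6)] bilin_hom_left[OF assms(2,6)] assms(3)
  show ?thesis using assms(5) by (rule lin_hom_basis_ext)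
qed

context
  fixes M (structure) and \<phi>
  assumes M: "module K M" and \<phi>: "\<phi> \<in> carrier G \<rightarrow> carrier M"
begin

interpretation M: module K M by (rule M)

text \<open>
  Summing over a larger finite set allows the supports of several elements to be treated together.
\<close>

lemma linear_extension_superset:
  assumes "f \<in> carrier H" "finite S" "supp K f \<subseteq> S" "S \<subseteq> carrier G"
  shows "linear_extension K M \<phi> f = (\<Oplus>\<^bsub>M\<^esub>g \<in> S. f g \<odot>\<^bsub>M\<^esub> \<phi> g)"
  unfolding linear_extension_def
proof (rule M.add.finprod_mono_neutral_cong_left)
  show "f g \<odot>\<^bsub>M\<^esub> \<phi> g = \<zero>\<^bsub>M\<^esub>" if "g \<in> S - supp K f" for g
    using that assms \<phi> M.smult_l_null[of "\<phi> g"] by (auto simp: supp_def Pi_iff)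
qed (use assms \<phi> H_D(1)[OF assms(1)] in \<open>auto intro!: M.smult_closed\<close>)

lemma linear_extension_linear: "linear_extension K M \<phi> \<in> lin_hom K H M"
proof (rule lin_homI)
  fix f assume f: "f \<in> carrier H"
  then show "linear_extension K M \<phi> f \<in> carrier M"
    using \<phi> H_D[OF f] unfolding linear_extension_def by (auto intro!: M.finsum_closed)
next
  fix f f' assume f: "f \<in> carrier H" and f': "f' \<in> carrier H"
  note D = H_D[OF f] H_D[OF f']
  let ?S = "supp K f \<union> supp K f'"
  have S: "finite ?S" "?S \<subseteq> carrier G" using D by auto
  have "linear_extension K M \<phi> (f \<oplus>\<^bsub>H\<^esub> f') = (\<Oplus>\<^bsub>M\<^esub>g \<in> ?S. (f \<oplus>\<^bsub>H\<^esub> f') g \<odot>\<^bsub>M\<^esub> \<phi> g)"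
    using S f f' by (intro linear_extension_superset add_closed_H) (auto simp: supp_def add_H)
  also have "\<dots> = (\<Oplus>\<^bsub>M\<^esub>g \<in> ?S. f g \<odot>\<^bsub>M\<^esub> \<phi> g \<oplus>\<^bsub>M\<^esub> f' g \<odot>\<^bsub>M\<^esub> \<phi> g)"
    using S D \<phi> by (intro M.add.finprod_cong') (auto simp: add_H M.smult_l_distr Pi_iff)
  also have "\<dots> = (\<Oplus>\<^bsub>M\<^esub>g \<in> ?S. f g \<odot>\<^bsub>M\<^esub> \<phi> g) \<oplus>\<^bsub>M\<^esub> (\<Oplus>\<^bsub>M\<^esub>g \<in> ?S. f' g \<odot>\<^bsub>M\<^esub> \<phi> g)"
    using S D \<phi> by (intro M.finsum_addf) (auto simp: Pi_iff)
  also have "\<dots> = linear_extension K M \<phi> f \<oplus>\<^bsub>M\<^esub> linear_extension K M \<phi> f'"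
    using S f f' linear_extension_superset[of f ?S] linear_extension_superset[of f' ?S] by simp
  finally show "linear_extension K M \<phi> (f \<oplus>\<^bsub>H\<^esub> f') =
    linear_extension K M \<phi> f \<oplus>\<^bsub>M\<^esub> linear_extension K M \<phi> f'" .
next
  fix a f assume a: "a \<in> carrier K" and f: "f \<in> carrier H"
  note D = H_D[OF f]
  have "linear_extension K M \<phi> (a \<odot>\<^bsub>H\<^esub> f) = (\<Oplus>\<^bsub>M\<^esub>g \<in> supp K f. (a \<odot>\<^bsub>H\<^esub> f) g \<odot>\<^bsub>M\<^esub> \<phi> g)"
    using D a f by (intro linear_extension_superset smult_closed_H) (auto simp: supp_def smult_H)
  also have "\<dots> = (\<Oplus>\<^bsub>M\<^esub>g \<in> supp K f. a \<odot>\<^bsub>M\<^esub> (f g \<odot>\<^bsub>M\<^esub> \<phi> g))"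
    using D a \<phi> by (intro M.add.finprod_cong') (auto simp: smult_H M.smult_assoc1 Pi_iff)
  also have "\<dots> = a \<odot>\<^bsub>M\<^esub> linear_extension K M \<phi> f"
    using D a \<phi> unfolding linear_extension_def
    by (intro M.finsum_smult_ldistr[symmetric]) (auto simp: Pi_iff)
  finally show "linear_extension K M \<phi> (a \<odot>\<^bsub>H\<^esub> f) = a \<odot>\<^bsub>M\<^esub> linear_extension K M \<phi> f" .
qed

lemma linear_extension_e: "g \<in> carrier G \<Longrightarrow> linear_extension K M \<phi> (e g) = \<phi> g"
  using \<phi> by (simp add: linear_extension_def supp_e e_same Pi_iff)

end

section \<open>The group algebra as an algebra\<close>

lemma finsum_H_apply:
  assumes "finite A" "F \<in> A \<rightarrow> carrier H"
  shows "(\<Oplus>\<^bsub>H\<^esub>g \<in> A. F g) x = (\<Oplus>g \<in> A. F g x)"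
  using assms
proof (induction A rule: finite_induct)
  case (insert g A)
  have "F h x \<in> carrier K" if "h \<in> insert g A" for h
    using insert.prems that by (intro H_D(1)) auto
  with insert show ?case by (simp add: add_H)
qed (simp add: zero_H)

lemma translate_closed: "g \<in> carrier G \<Longrightarrow> (\<lambda>h. e (g \<otimes>\<^bsub>G\<^esub> h)) \<in> carrier G \<rightarrow> carrier H"
  by (simp add: e_closed)

lemma translate_extension_closed:
  assumes "f' \<in> carrier H"
  shows "(\<lambda>g. linear_extension K H (\<lambda>h. e (g \<otimes>\<^bsub>G\<^esub> h)) f') \<in> carrier G \<rightarrow> carrier H"
  using assms by (auto intro: lin_hom_closed[OF linear_extension_linear[OF module_H translate_closed]])

text \<open>
  The convolution product is the bilinear extension of the multiplication of the group. In this form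
  its linearity and its values on basis vectors come from general facts on linear extensions, and
  no further computation with sums over fibres of the multiplication occurs.
\<close>

lemma mult_H_linear_extension:
  assumes f: "f \<in> carrier H" and f': "f' \<in> carrier H"
  shows "f \<otimes>\<^bsub>H\<^esub> f' = linear_extension K H (\<lambda>g. linear_extension K H (\<lambda>h. e (g \<otimes>\<^bsub>G\<^esub> h)) f') f"
proof
  fix x
  note D = H_D[OF f] H_D[OF f']
  have inner: "(f g \<odot>\<^bsub>H\<^esub> linear_extension K H (\<lambda>h. e (g \<otimes>\<^bsub>G\<^esub> h)) f') x =
      (\<Oplus>h \<in> {h \<in> supp K f'. g \<otimes>\<^bsub>G\<^esub> h = x}. f g \<otimes> f' h)" if g: "g \<in> supp K f" for g
  proof -
    have gG: "g \<in> carrier G" using g D by auto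
    have "(f g \<odot>\<^bsub>H\<^esub> linear_extension K H (\<lambda>h. e (g \<otimes>\<^bsub>G\<^esub> h)) f') x =
        f g \<otimes> (\<Oplus>h \<in> supp K f'. f' h \<otimes> e (g \<otimes>\<^bsub>G\<^esub> h) x)"
      using D gG unfolding linear_extension_def
      by (subst smult_H, subst finsum_H_apply)
        (auto intro!: smult_closed_H e_closed, simp add: smult_H)
    also have "\<dots> = (\<Oplus>h \<in> supp K f'. f g \<otimes> (f' h \<otimes> e (g \<otimes>\<^bsub>G\<^esub> h) x))"
      using D by (intro K.finsum_rdistr) (auto simp: group_elem_def)
    (* The basis vector of gh takes the value 1 at x if gh = x, and 0 otherwise. *)
    also have "\<dots> = (\<Oplus>h \<in> {h \<in> supp K f'. g \<otimes>\<^bsub>G\<^esub> h = x}. f g \<otimes> f' h)"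
      using D by (intro K.add.finprod_mono_neutral_cong_right) (auto simp: group_elem_def)
    finally show ?thesis .
  qed
  have "linear_extension K H (\<lambda>g. linear_extension K H (\<lambda>h. e (g \<otimes>\<^bsub>G\<^esub> h)) f') f x =
      (\<Oplus>g \<in> supp K f. (f g \<odot>\<^bsub>H\<^esub> linear_extension K H (\<lambda>h. e (g \<otimes>\<^bsub>G\<^esub> h)) f') x)"
    unfolding linear_extension_def[of K H _ f]
    using D translate_extension_closed[OF f'] by (intro finsum_H_apply) (auto intro!: smult_closed_H)
  also have "\<dots> = (f \<otimes>\<^bsub>H\<^esub> f') x"
    unfolding mult_H using D inner
    by (intro K.add.finprod_cong') (auto intro!: K.finsum_closed)
  finally show "(f \<otimes>\<^bsub>H\<^esub> f') x =
    linear_extension K H (\<lambda>g. linear_extension K H (\<lambda>h. e (g \<otimes>\<^bsub>G\<^esub> h)) f') f x" ..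
qed

lemma mult_e: "\<lbrakk>g \<in> carrier G; h \<in> carrier G\<rbrakk> \<Longrightarrow> e g \<otimes>\<^bsub>H\<^esub> e h = e (g \<otimes>\<^bsub>G\<^esub> h)"
  by (simp add: mult_H_linear_extension e_closed
      linear_extension_e[OF module_H translate_closed] linear_extension_e[OF module_H translate_extension_closed])

text \<open>
  Linearity in the first factor is that of a linear extension. For linearity in the second factor the
  first one is varied over sums of multiples of group elements, for which left multiplication is
  itself a linear extension.
\<close>

lemma mult_H_bilin: "monoid.mult H \<in> bilin_hom K H H H"
proof -
  have left: "(\<lambda>f. f \<otimes>\<^bsub>H\<^esub> f') \<in> lin_hom K H H" if f': "f' \<in> carrier H" for f'
    using linear_extension_linear[OF module_H translate_extension_closed[OF f']]
    by (simp add: lin_hom_def mult_H_linear_extension f' add_closed_H smult_closed_H Pi_iff)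
  have e_left: "monoid.mult H (e g) \<in> lin_hom K H H" if g: "g \<in> carrier G" for g
    using linear_extension_linear[OF module_H translate_closed[OF g]] g
    by (simp add: lin_hom_def mult_H_linear_extension e_closed add_closed_H smult_closed_H Pi_iff
        linear_extension_e[OF module_H translate_extension_closed])
  note left_add = lin_hom_add[OF left] and left_smult = lin_hom_smult[OF left]
    and closed = lin_hom_closed[OF left]
  have "monoid.mult H f \<in> lin_hom K H H" if f: "f \<in> carrier H" for f
  proof (rule lin_homI)
    fix y assume "y \<in> carrier H"
    then show "f \<otimes>\<^bsub>H\<^esub> y \<in> carrier H" using f closed by simp
  next
    fix y z assume yz: "y \<in> carrier H" "z \<in> carrier H"
    show "f \<otimes>\<^bsub>H\<^esub> (y \<oplus>\<^bsub>H\<^esub> z) = f \<otimes>\<^bsub>H\<^esub> y \<oplus>\<^bsub>H\<^esub> f \<otimes>\<^bsub>H\<^esub> z"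
      using f
    proof (induction f rule: basis_induct)
      case zero
      then show ?case using yz by (simp add: lin_hom_zero[OF left module_H])
    next
      case (add f f')
      then show ?case using yz by (simp add: left_add closed H.M.a_ac)
    next
      case (basis a g)
      then show ?case
        using yz lin_hom_add[OF e_left]
        by (simp add: left_smult e_closed closed H.smult_r_distr)
    qed
  next
    fix b y assume y: "b \<in> carrier K" "y \<in> carrier H"
    show "f \<otimes>\<^bsub>H\<^esub> (b \<odot>\<^bsub>H\<^esub> y) = b \<odot>\<^bsub>H\<^esub> (f \<otimes>\<^bsub>H\<^esub> y)"
      using f
    proof (induction f rule: basis_induct)
      case zero
      then show ?case using y by (simp add: lin_hom_zero[OF left module_H])
    next
      case (add f f')
      then show ?case using y by (simp add: left_add closed H.smult_r_distr)
    next
      case (basis a g)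
      then show ?case
        using y lin_hom_smult[OF e_left]
        by (simp add: left_smult e_closed closed K.m_comm flip: H.smult_assoc1)
    qed
  qed
  then show ?thesis using left by (intro bilin_homI)
qed

lemmas mult_H_left = bilin_hom_left[OF mult_H_bilin]
lemmas mult_H_right = bilin_hom_right[OF mult_H_bilin]
lemmas mult_H_closed = bilin_hom_closed[OF mult_H_bilin]

lemma one_H_closed: "\<one>\<^bsub>H\<^esub> \<in> carrier H"
  by (simp add: one_H e_closed)

text \<open>
  Associativity compares two maps linear in each of three arguments; these are replaced by group
  elements one after the other, until associativity in the group remains.
\<close>

lemma ring_H: "ring H"
proof (rule ringI)
  show "monoid H"
  proof (rule monoidI)
    fix x y z assume "x \<in> carrier H" and y: "y \<in> carrier H" and z: "z \<in> carrier H"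
    show "x \<otimes>\<^bsub>H\<^esub> y \<otimes>\<^bsub>H\<^esub> z = x \<otimes>\<^bsub>H\<^esub> (y \<otimes>\<^bsub>H\<^esub> z)"
    proof (rule lin_hom_basis_ext[OF lin_hom_compose[OF mult_H_left[OF y] mult_H_left[OF z]]
            mult_H_left[OF mult_H_closed[OF y z]] module_H _ \<open>x \<in> carrier H\<close>])
      fix g assume g: "g \<in> carrier G"
      note gH = e_closed[OF g]
      show "e g \<otimes>\<^bsub>H\<^esub> y \<otimes>\<^bsub>H\<^esub> z = e g \<otimes>\<^bsub>H\<^esub> (y \<otimes>\<^bsub>H\<^esub> z)"
      proof (rule lin_hom_basis_ext[OF lin_hom_compose[OF mult_H_right[OF gH] mult_H_left[OF z]]
              lin_hom_compose[OF mult_H_left[OF z] mult_H_right[OF gH]] module_H _ y])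
        fix h assume h: "h \<in> carrier G"
        note hH = e_closed[OF h]
        show "e g \<otimes>\<^bsub>H\<^esub> e h \<otimes>\<^bsub>H\<^esub> z = e g \<otimes>\<^bsub>H\<^esub> (e h \<otimes>\<^bsub>H\<^esub> z)"
          by (rule lin_hom_basis_ext[OF mult_H_right[OF mult_H_closed[OF gH hH]]
                lin_hom_compose[OF mult_H_right[OF hH] mult_H_right[OF gH]] module_H _ z])
            (simp add: g h mult_e G.m_assoc)
      qed
    qed
  next
    fix x assume x: "x \<in> carrier H"
    show "\<one>\<^bsub>H\<^esub> \<otimes>\<^bsub>H\<^esub> x = x"
      using lin_hom_basis_ext[OF mult_H_right[OF one_H_closed] lin_hom_id module_H _ x]
      by (simp add: one_H mult_e)
    show "x \<otimes>\<^bsub>H\<^esub> \<one>\<^bsub>H\<^esub> = x"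
      using lin_hom_basis_ext[OF mult_H_left[OF one_H_closed] lin_hom_id module_H _ x]
      by (simp add: one_H mult_e)
  qed (simp_all add: mult_H_closed one_H_closed)
qed (simp_all add: H.M.abelian_group_axioms lin_hom_add[OF mult_H_left] lin_hom_add[OF mult_H_right])

lemma assoc_algebra_H: "assoc_algebra K H"
  by (intro assoc_algebra.intro assoc_algebra_axioms.intro module_H ring_H)
    (simp_all add: lin_hom_smult[OF mult_H_left] lin_hom_smult[OF mult_H_right])

end


section \<open>The group algebra as a Hopf algebra\<close>

text \<open>
  Tensor products and linear extensions depend only on the operations of the modules involved. This
  identifies the two records for the group algebra, with and without the Hopf algebra structure.
\<close>

lemma tensor_cong:
  assumes "carrier M = carrier M'" "add M = add M'" "smult M = smult M'"
    "monoid.mult M = monoid.mult M'" "one M = one M'"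
  shows "tensor K M M = tensor K M' M'" "pure_tensor K M M = pure_tensor K M' M'"
proof -
  have "tensor_class K M M = tensor_class K M' M'" "tensor_null K M M = tensor_null K M' M'"
    using assms by (simp_all add: fun_eq_iff tensor_class_def tensor_null_def tensor_rels_def)
  then show "pure_tensor K M M = pure_tensor K M' M'" "tensor K M M = tensor K M' M'"
    using assms by (simp_all add: fun_eq_iff tensor_def pure_tensor_def)
qed

lemma linear_extension_cong:
  assumes "carrier M = carrier M'" "add M = add M'" "\<zero>\<^bsub>M\<^esub> = \<zero>\<^bsub>M'\<^esub>" "smult M = smult M'"
  shows "linear_extension K M = linear_extension K M'"
  by (intro ext) (simp add: linear_extension_def finsum_def finprod_def assms)

lemma (in field) module_scalars: "module R (scalars R)"
proof (rule moduleI)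
  show "abelian_group (scalars R)"
  proof (rule abelian_groupI)
    fix a assume "a \<in> carrier (scalars R)"
    then show "\<exists>b \<in> carrier (scalars R). b \<oplus>\<^bsub>scalars R\<^esub> a = \<zero>\<^bsub>scalars R\<^esub>"
      by (intro bexI[of _ "\<ominus> a"]) (simp_all add: scalars_def l_neg)
  qed (simp_all add: scalars_def a_ac)
qed (simp_all add: scalars_def l_distr r_distr m_assoc is_cring)

context field_group
begin

lemma comult_H:
  "comult H = linear_extension K (tensor K H H) (\<lambda>g. pure_tensor K H H (e g) (e g))"
proof -
  have "comult H = linear_extension K (tensor K (group_algebra K G) (group_algebra K G))
      (\<lambda>g. pure_tensor K (group_algebra K G) (group_algebra K G) (e g) (e g))"
    by (simp add: group_hopf_algebra_def Let_def)
  moreover have "tensor K (group_algebra K G) (group_algebra K G) = tensor K H H"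
    "pure_tensor K (group_algebra K G) (group_algebra K G) = pure_tensor K H H"
    by (rule tensor_cong; simp add: group_hopf_algebra_def Let_def)+
  ultimately show ?thesis by simp
qed

lemma linear_extension_group_algebra: "linear_extension K (group_algebra K G) = linear_extension K H"
  by (rule linear_extension_cong) (simp_all add: group_hopf_algebra_def Let_def)

lemma antipode_H: "antipode H = linear_extension K H (\<lambda>g. e (inv\<^bsub>G\<^esub> g))"
  unfolding linear_extension_group_algebra[symmetric]
  by (simp add: group_hopf_algebra_def Let_def)

lemma counit_H: "counit H = linear_extension K (scalars K) (\<lambda>g. \<one>)"
  by (simp add: group_hopf_algebra_def Let_def)

lemma group_algebra_map_H: "group_algebra_map K G \<AA> = linear_extension K H (\<lambda>g. e (\<AA> g))"
  by (simp add: group_algebra_map_def linear_extension_group_algebra)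

sublocale HH: algebra_pair K H H
  by (intro algebra_pair.intro assoc_algebra_H)

sublocale S: module K "scalars K"
  by (rule K.module_scalars)

sublocale SH: module_pair K "scalars K" H ..
sublocale HS: module_pair K H "scalars K" ..
sublocale L: module_pair K HH.T H by (intro module_pair.intro HH.module_T module_H)
sublocale R: module_pair K H HH.T by (intro module_pair.intro HH.module_T module_H)

lemma scalars_simps:
  "carrier (scalars K) = carrier K" "\<one>\<^bsub>scalars K\<^esub> = \<one>" "a \<odot>\<^bsub>scalars K\<^esub> b = a \<otimes> b"
  "a \<oplus>\<^bsub>scalars K\<^esub> b = a \<oplus> b"
  by (simp_all add: scalars_def)

lemma comult_linear: "comult H \<in> lin_hom K H HH.T"
  unfolding comult_H
  by (rule linear_extension_linear[OF HH.module_T]) (simp add: HH.pure_closed e_closed)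

lemma comult_e: "g \<in> carrier G \<Longrightarrow> comult H (e g) = HH.pure (e g) (e g)"
  unfolding comult_H
  by (rule linear_extension_e[OF HH.module_T]) (simp_all add: HH.pure_closed e_closed)

lemma counit_linear: "counit H \<in> lin_hom K H (scalars K)"
  unfolding counit_H
  by (rule linear_extension_linear[OF S.module_axioms]) (simp add: scalars_simps)

lemma counit_e: "g \<in> carrier G \<Longrightarrow> counit H (e g) = \<one>"
  unfolding counit_H
  by (rule linear_extension_e[OF S.module_axioms]) (simp_all add: scalars_simps)

lemma antipode_linear: "antipode H \<in> lin_hom K H H"
  unfolding antipode_H
  by (rule linear_extension_linear[OF module_H]) (simp add: e_closed)

lemma antipode_e: "g \<in> carrier G \<Longrightarrow> antipode H (e g) = e (inv\<^bsub>G\<^esub> g)"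
  unfolding antipode_H
  by (rule linear_extension_e[OF module_H]) (simp_all add: e_closed)

lemma smult_bilin: "(\<lambda>a x. a \<odot>\<^bsub>H\<^esub> x) \<in> bilin_hom K (scalars K) H H"
  by (intro bilin_homI lin_homI)
    (simp_all add: scalars_simps H.smult_l_distr H.smult_r_distr H.smult_assoc1 K.m_comm
      flip: H.smult_assoc1)

lemma smult_bilin_flipped: "(\<lambda>x a. a \<odot>\<^bsub>H\<^esub> x) \<in> bilin_hom K H (scalars K) H"
  using smult_bilin by (simp add: bilin_hom_def)

text \<open>
  On a group element \<open>g\<close> both sides of coassociativity are \<open>g \<otimes> (g \<otimes> g)\<close>, and the
  counit laws say \<open>1 g = g\<close>. Everything else is linearity of the composites.
\<close>

lemma coalgebra_H: "coalgebra K H"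
proof (intro coalgebra.intro coalgebra_axioms.intro K.field_axioms module_H
    comult_linear counit_linear)
  fix x assume x: "x \<in> carrier H"
  have l: "tensor_map K HH.T H (comult H) id \<in> lin_hom K HH.T L.T"
    and l_pure: "\<And>y z. \<lbrakk>y \<in> carrier H; z \<in> carrier H\<rbrakk> \<Longrightarrow>
      tensor_map K HH.T H (comult H) id (HH.pure y z) = L.pure (comult H y) z"
    using L.tensor_map_linear[OF comult_linear lin_hom_id module_H module_H]
      L.tensor_map_pure[OF comult_linear lin_hom_id module_H module_H] by simp_all
  have r: "tensor_map K H HH.T id (comult H) \<in> lin_hom K HH.T R.T"
    and r_pure: "\<And>y z. \<lbrakk>y \<in> carrier H; z \<in> carrier H\<rbrakk> \<Longrightarrow>
      tensor_map K H HH.T id (comult H) (HH.pure y z) = R.pure y (comult H z)"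
    using R.tensor_map_linear[OF lin_hom_id comult_linear module_H module_H]
      R.tensor_map_pure[OF lin_hom_id comult_linear module_H module_H] by simp_all
  note a = tensor_assoc_linear[OF module_H module_H module_H]
    and a_pure = tensor_assoc_pure[OF module_H module_H module_H]
  show "tensor_assoc K H H H (tensor_map K HH.T H (comult H) id (comult H x)) =
      tensor_map K H HH.T id (comult H) (comult H x)"
    using lin_hom_compose[OF comult_linear lin_hom_compose[OF l a]]
      lin_hom_compose[OF comult_linear r] R.module_T _ x
    by (rule lin_hom_basis_ext) (simp add: comult_e e_closed l_pure r_pure a_pure)
next
  fix x assume x: "x \<in> carrier H"
  note t = SH.tensor_map_linear[OF counit_linear lin_hom_id module_H module_H]
    and t_pure = SH.tensor_map_pure[OF counit_linear lin_hom_id module_H module_H]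
  note l = SH.tensor_lift_linear[OF module_H smult_bilin]
    and l_pure = SH.tensor_lift_pure[OF module_H smult_bilin]
  have "tensor_lift H (\<lambda>a y. a \<odot>\<^bsub>H\<^esub> y) (tensor_map K (scalars K) H (counit H) id (comult H x)) = id x"
    using lin_hom_compose[OF comult_linear lin_hom_compose[OF t l]] lin_hom_id module_H _ x
    by (rule lin_hom_basis_ext) (simp add: comult_e e_closed counit_e t_pure l_pure scalars_simps)
  then show "tensor_lift H (\<lambda>a y. a \<odot>\<^bsub>H\<^esub> y)
      (tensor_map K (scalars K) H (counit H) id (comult H x)) = x" by simp
next
  fix x assume x: "x \<in> carrier H"
  note t = HS.tensor_map_linear[OF lin_hom_id counit_linear module_H module_H]
    and t_pure = HS.tensor_map_pure[OF lin_hom_id counit_linear module_H module_H]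
  note l = HS.tensor_lift_linear[OF module_H smult_bilin_flipped]
    and l_pure = HS.tensor_lift_pure[OF module_H smult_bilin_flipped]
  have "tensor_lift H (\<lambda>y a. a \<odot>\<^bsub>H\<^esub> y) (tensor_map K H (scalars K) id (counit H) (comult H x)) = id x"
    using lin_hom_compose[OF comult_linear lin_hom_compose[OF t l]] lin_hom_id module_H _ x
    by (rule lin_hom_basis_ext) (simp add: comult_e e_closed counit_e t_pure l_pure scalars_simps)
  then show "tensor_lift H (\<lambda>y a. a \<odot>\<^bsub>H\<^esub> y)
      (tensor_map K H (scalars K) id (counit H) (comult H x)) = x" by simp
qed

text \<open>
  A linear map is multiplicative as soon as it is so on group elements, since both sides of the
  equation are bilinear.
\<close>

lemma lin_hom_mult_ext:
  assumes f: "f \<in> lin_hom K H P" and P: "module K P" and \<beta>: "\<beta> \<in> bilin_hom K P P P"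
    and "\<And>g h. \<lbrakk>g \<in> carrier G; h \<in> carrier G\<rbrakk> \<Longrightarrow> f (e (g \<otimes>\<^bsub>G\<^esub> h)) = \<beta> (f (e g)) (f (e h))"
    and "x \<in> carrier H" "y \<in> carrier H"
  shows "f (x \<otimes>\<^bsub>H\<^esub> y) = \<beta> (f x) (f y)"
  using lin_hom_bilin_hom_compose[OF mult_H_bilin f] bilin_hom_compose[OF f f \<beta>] P _ assms(5,6)
  by (rule bilin_hom_basis_ext) (simp add: mult_e assms(4))

lemma bialgebra_H: "bialgebra K H"
proof (intro bialgebra.intro bialgebra_axioms.intro coalgebra_H assoc_algebra_H ring_hom_memI)
  fix x y assume "x \<in> carrier H" "y \<in> carrier H"
  with comult_linear HH.module_T HH.mult_bilin _
  show "comult H (x \<otimes>\<^bsub>H\<^esub> y) = comult H x \<otimes>\<^bsub>HH.T\<^esub> comult H y"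
    by (rule lin_hom_mult_ext) (simp add: comult_e HH.mult_pure e_closed mult_e)
next
  have K_mult: "monoid.mult K \<in> bilin_hom K (scalars K) (scalars K) (scalars K)"
    by (intro bilin_homI lin_homI) (simp_all add: scalars_simps K.l_distr K.r_distr K.m_ac)
  fix x y assume "x \<in> carrier H" "y \<in> carrier H"
  with counit_linear S.module_axioms K_mult _
  show "counit H (x \<otimes>\<^bsub>H\<^esub> y) = counit H x \<otimes> counit H y"
    by (rule lin_hom_mult_ext) (simp add: counit_e)
next
  show "comult H \<one>\<^bsub>H\<^esub> = \<one>\<^bsub>HH.T\<^esub>"
    by (simp add: one_H comult_e) (simp add: tensor_def Let_def one_H)
next
  show "counit H \<one>\<^bsub>H\<^esub> = \<one>" by (simp add: one_H counit_e)
qed (use lin_hom_closed[OF counit_linear] lin_hom_add[OF counit_linear]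
    in \<open>simp_all add: lin_hom_closed[OF comult_linear] lin_hom_add[OF comult_linear] scalars_simps\<close>)

text \<open>
  On a group element both antipode laws become \<open>g\<inverse> g = 1 = g g\<inverse>\<close>.
\<close>

lemma hopf_algebra_H: "hopf_algebra K H"
proof (intro hopf_algebra.intro hopf_algebra_axioms.intro bialgebra_H antipode_linear)
  have unit: "(\<lambda>x. counit H x \<odot>\<^bsub>H\<^esub> \<one>\<^bsub>H\<^esub>) \<in> lin_hom K H H"
    by (rule lin_hom_compose[OF counit_linear bilin_hom_left[OF smult_bilin one_H_closed]])
  note m = HH.tensor_lift_linear[OF module_H mult_H_bilin]
    and m_pure = HH.tensor_lift_pure[OF module_H mult_H_bilin]
  fix x assume x: "x \<in> carrier H"
  note t = HH.tensor_map_linear[OF antipode_linear lin_hom_id module_H module_H]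
    and t_pure = HH.tensor_map_pure[OF antipode_linear lin_hom_id module_H module_H]
  show "tensor_lift H (\<lambda>y z. y \<otimes>\<^bsub>H\<^esub> z) (tensor_map K H H (antipode H) id (comult H x)) =
      counit H x \<odot>\<^bsub>H\<^esub> \<one>\<^bsub>H\<^esub>"
    using lin_hom_compose[OF comult_linear lin_hom_compose[OF t m]] unit module_H _ x
    by (rule lin_hom_basis_ext)
      (simp add: comult_e e_closed counit_e antipode_e t_pure m_pure mult_e one_H)
  note t = HH.tensor_map_linear[OF lin_hom_id antipode_linear module_H module_H]
    and t_pure = HH.tensor_map_pure[OF lin_hom_id antipode_linear module_H module_H]
  show "tensor_lift H (\<lambda>y z. y \<otimes>\<^bsub>H\<^esub> z) (tensor_map K H H id (antipode H) (comult H x)) =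
      counit H x \<odot>\<^bsub>H\<^esub> \<one>\<^bsub>H\<^esub>"
    using lin_hom_compose[OF comult_linear lin_hom_compose[OF t m]] unit module_H _ x
    by (rule lin_hom_basis_ext)
      (simp add: comult_e e_closed counit_e antipode_e t_pure m_pure mult_e one_H)
qed


section \<open>Averaging operators\<close>

context
  fixes \<AA> assumes \<AA>: "\<AA> \<in> carrier G \<rightarrow> carrier G"
begin

lemma \<AA>_closed: "g \<in> carrier G \<Longrightarrow> \<AA> g \<in> carrier G"
  using \<AA> by auto

lemma group_algebra_map_linear: "group_algebra_map K G \<AA> \<in> lin_hom K H H"
  unfolding group_algebra_map_H
  by (rule linear_extension_linear[OF module_H]) (simp add: e_closed \<AA>_closed)

lemma group_algebra_map_e: "g \<in> carrier G \<Longrightarrow> group_algebra_map K G \<AA> (e g) = e (\<AA> g)"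
  unfolding group_algebra_map_H
  by (rule linear_extension_e[OF module_H]) (simp_all add: e_closed \<AA>_closed)

text \<open>
  Group elements are sent to group elements, and every group element \<open>g\<close> has the coproduct
  \<open>g \<otimes> g\<close> and the counit \<open>1\<close>.
\<close>

lemma group_algebra_map_coalgebra_hom: "group_algebra_map K G \<AA> \<in> coalgebra_hom K H H"
proof -
  let ?A = "group_algebra_map K G \<AA>"
  note A = group_algebra_map_linear and A_e = group_algebra_map_e
  note t = HH.tensor_map_linear[OF A A module_H module_H]
    and t_pure = HH.tensor_map_pure[OF A A module_H module_H]
  have "comult H (?A x) = tensor_map K H H ?A ?A (comult H x)" if "x \<in> carrier H" for x
    using lin_hom_compose[OF A comult_linear] lin_hom_compose[OF comult_linear t] HH.module_T _ that
    by (rule lin_hom_basis_ext) (simp add: A_e comult_e \<AA>_closed t_pure e_closed)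
  moreover have "counit H (?A x) = counit H x" if "x \<in> carrier H" for x
    using lin_hom_compose[OF A counit_linear] counit_linear S.module_axioms _ that
    by (rule lin_hom_basis_ext) (simp add: A_e counit_e \<AA>_closed)
  ultimately show ?thesis using A by (simp add: coalgebra_hom_def)
qed

text \<open>
  Both sides of the identity on the algebra are bilinear, so it holds if it holds on group elements.
  Conversely it restricts to group elements, and distinct group elements remain distinct in the
  algebra because \<open>1 \<noteq> 0\<close> in \<open>K\<close>.
\<close>

lemma averaging_left_iff:
  "(\<forall>x \<in> carrier H. \<forall>y \<in> carrier H. group_algebra_map K G \<AA> x \<otimes>\<^bsub>H\<^esub> group_algebra_map K G \<AA> y =
      group_algebra_map K G \<AA> (group_algebra_map K G \<AA> x \<otimes>\<^bsub>H\<^esub> y)) \<longleftrightarrow>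
    (\<forall>g \<in> carrier G. \<forall>h \<in> carrier G. \<AA> g \<otimes>\<^bsub>G\<^esub> \<AA> h = \<AA> (\<AA> g \<otimes>\<^bsub>G\<^esub> h))"
  (is "?L \<longleftrightarrow> ?R")
proof
  note A = group_algebra_map_linear and A_e = group_algebra_map_e
  show ?R if L: ?L
  proof (intro ballI)
    fix g h assume "g \<in> carrier G" "h \<in> carrier G"
    then show "\<AA> g \<otimes>\<^bsub>G\<^esub> \<AA> h = \<AA> (\<AA> g \<otimes>\<^bsub>G\<^esub> h)"
      using L[rule_format, of "e g" "e h"] by (simp add: A_e mult_e e_closed \<AA>_closed e_inject)
  qed
  show ?L if R: ?R
  proof (intro ballI)
    fix x y assume x: "x \<in> carrier H" and y: "y \<in> carrier H"
    have "(\<lambda>x y. group_algebra_map K G \<AA> (group_algebra_map K G \<AA> x \<otimes>\<^bsub>H\<^esub> y))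
        \<in> bilin_hom K H H H"
      using lin_hom_bilin_hom_compose[OF bilin_hom_compose[OF A lin_hom_id mult_H_bilin] A] by simp
    with bilin_hom_compose[OF A A mult_H_bilin]
    show "group_algebra_map K G \<AA> x \<otimes>\<^bsub>H\<^esub> group_algebra_map K G \<AA> y =
        group_algebra_map K G \<AA> (group_algebra_map K G \<AA> x \<otimes>\<^bsub>H\<^esub> y)"
      using module_H _ x y
      by (rule bilin_hom_basis_ext) (simp add: A_e mult_e \<AA>_closed R)
  qed
qed

lemma averaging_right_iff:
  "(\<forall>x \<in> carrier H. \<forall>y \<in> carrier H. group_algebra_map K G \<AA> x \<otimes>\<^bsub>H\<^esub> group_algebra_map K G \<AA> y =
      group_algebra_map K G \<AA> (x \<otimes>\<^bsub>H\<^esub> group_algebra_map K G \<AA> y)) \<longleftrightarrow>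
    (\<forall>g \<in> carrier G. \<forall>h \<in> carrier G. \<AA> g \<otimes>\<^bsub>G\<^esub> \<AA> h = \<AA> (g \<otimes>\<^bsub>G\<^esub> \<AA> h))"
  (is "?L \<longleftrightarrow> ?R")
proof
  note A = group_algebra_map_linear and A_e = group_algebra_map_e
  show ?R if L: ?L
  proof (intro ballI)
    fix g h assume "g \<in> carrier G" "h \<in> carrier G"
    then show "\<AA> g \<otimes>\<^bsub>G\<^esub> \<AA> h = \<AA> (g \<otimes>\<^bsub>G\<^esub> \<AA> h)"
      using L[rule_format, of "e g" "e h"] by (simp add: A_e mult_e e_closed \<AA>_closed e_inject)
  qed
  show ?L if R: ?R
  proof (intro ballI)
    fix x y assume x: "x \<in> carrier H" and y: "y \<in> carrier H"
    have "(\<lambda>x y. group_algebra_map K G \<AA> (x \<otimes>\<^bsub>H\<^esub> group_algebra_map K G \<AA> y))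
        \<in> bilin_hom K H H H"
      using lin_hom_bilin_hom_compose[OF bilin_hom_compose[OF lin_hom_id A mult_H_bilin] A] by simp
    with bilin_hom_compose[OF A A mult_H_bilin]
    show "group_algebra_map K G \<AA> x \<otimes>\<^bsub>H\<^esub> group_algebra_map K G \<AA> y =
        group_algebra_map K G \<AA> (x \<otimes>\<^bsub>H\<^esub> group_algebra_map K G \<AA> y)"
      using module_H _ x y
      by (rule bilin_hom_basis_ext) (simp add: A_e mult_e \<AA>_closed R)
  qed
qed

end

end

theorem theorem3p13:
  fixes K :: "('k, 'r) ring_scheme"
    and G :: "('g, 's) monoid_scheme"
    and \<AA> :: "'g \<Rightarrow> 'g"
  assumes "field K"
    and "group G"
    and "\<AA> \<in> carrier G \<rightarrow> carrier G"
  shows "averaging_group G \<AA> \<longleftrightarrow>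
    averaging_hopf_algebra K (group_hopf_algebra K G) (group_algebra_map K G \<AA>)"
proof -
  interpret field_group K G by (intro field_group.intro assms)
  show ?thesis
    using averaging_left_iff[OF assms(3)] averaging_right_iff[OF assms(3)]
      hopf_algebra_H group_algebra_map_coalgebra_hom[OF assms(3)] assms(2,3)
    unfolding averaging_group_def averaging_group_axioms_def
      averaging_hopf_algebra_def averaging_hopf_algebra_axioms_def
    by auto
qed

end
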